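(* Assume that condition $\operatorname{w3}(\mathscr A,p,\sigma)$ is not satisfied for some parameters $1<p<\infty$ and $0<\sigma<p$. Then for each positive integer $N$ there exists a chain of atoms $(X_i)_{i=0}^n$ such that the function $f=\mathbf 1_{X_0\setminus X_n}-\gamma\mathbf 1_{X_n}$ (with $\gamma$ chosen so that $\mathbb Ef=0$) satisfies, with implicit constants independent of $N$: (1) $\|f\|_{V_{\sigma,p}}=\big\|\sum_\ell\langle f,\varphi_\ell\rangle\varphi_\ell\big\|_{V_{\sigma,p}}\lesssim|X_0\setminus X_n|^{1/p}$; (2) there exists a subset $\Gamma$ of the Haar support $\{\ell:\langle f,\varphi_\ell\rangle\ne0\}$ of $f$ such that $$\Big|\sum_{\ell\in\Gamma}\langle f,\varphi_\ell\rangle\varphi_\ell\Big|_{V_{\sigma,p}}\gtrsim N|X_0\setminus X_n|^{1/p}.$$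
   Context: $\Omega=[0,1)$ with Lebesgue measure $|\cdot|$, and $S=\operatorname{span}\{\mathbf 1_\Omega\}$. $(\mathscr F_n)_{n\ge0}$ is a binary filtration: $\mathscr F_0=\{\emptyset,\Omega\}$ and, for $n\ge1$, $\mathscr F_n$ is generated by $\mathscr F_{n-1}$ and the subdivision of exactly one atom $A_n$ of $\mathscr F_{n-1}$ into two atoms $A_n',A_n''$ of $\mathscr F_n$ with $|A_n''|\ge|A_n'|>0$. $\mathscr A$ is the set of all atoms of all $\mathscr F_n$; for $A\in\mathscr A$ that is eventually subdivided, $A',A''$ denote its two direct successors. A chain of atoms is a sequence $X_0\supset X_1\supset\cdots\supset X_n$ in $\mathscr A$ with $X_j\in\{X_{j-1}',X_{j-1}''\}$ for each $j=1,\dots,n$. A ring is a nonempty difference $A\setminus B$ with $A,B\in\mathscr A$, $B\subsetneq A$. $(\varphi_\ell)$ is the corresponding generalized Haar system: the $L^2$-orthonormal system consisting of $\mathbf 1_\Omega$ and, for each subdivided atom $A_n$, the $L^2$-normalized mean-zero function supported in $A_n$ that is constant on $A_n'$ and on $A_n''$. $\langle f,g\rangle=\int_\Omega fg$. $L^p(S)$ is the closure in $L^p(\Omega)$ of $\operatorname{span}\{\mathbf 1_A:A\in\mathscr A\}$. $E_p(f,R)=\inf_c\|f-c\|_{L^p(R)}$ over constants $c$; $|f|_{V_{\sigma,p}}=\sup_\Pi\big(\sum_{R\in\Pi}E_p(f,R)^\sigma\big)^{1/\sigma}$, supremum over all finite collections $\Pi$ of pairwise disjoint atoms or rings; $\|f\|_{V_{\sigma,p}}=\|f\|_p+|f|_{V_{\sigma,p}}$.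 Condition $\operatorname{w3}(\mathscr A,p,\sigma)$: there exist $\rho\in(0,1)$ and $M>0$ such that for each chain of atoms $X_0\supset X_1\supset\cdots\supset X_n$ with $|X_n|\ge\rho|X_0|$, all partitions $(\Lambda_i)_i$ of $\{0,\dots,n-1\}$ into sets of consecutive indices $\Lambda_i=\{\lambda_i,\dots,\lambda_{i+1}-1\}$, and all $\Gamma_i\subset\Lambda_i$, setting $R_i=\bigcup_{j\in\Lambda_i}X_j\setminus X_{j+1}=X_{\lambda_i}\setminus X_{\lambda_{i+1}}$ and $Q_i=\bigcup_{j\in\Gamma_i}X_j\setminus X_{j+1}$, one has $$\Big(\sum_i\min(|Q_i|,|R_i\setminus Q_i|)^{\sigma/p}\Big)^{1/\sigma}\le M|X_0\setminus X_n|^{1/p}.$$ *)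

theory Defs
  imports "HOL-Analysis.Analysis"
begin

abbreviation Om :: "real set" where
  "Om \<equiv> {0..<1}"

abbreviation vol :: "real set \<Rightarrow> real" where
  "vol A \<equiv> measure lebesgue A"

text \<open>
  Functions on \<open>[0,1)\<close> are represented by functions on the reals, of which only the values
  on \<open>Om\<close> matter. \<open>Lp_norm\<close> and the (semi)norms built from it are meant for p-integrable
  functions; for others the Lebesgue integral takes the default value \<open>0\<close>.
\<close>

definition inner_Om :: "(real \<Rightarrow> real) \<Rightarrow> (real \<Rightarrow> real) \<Rightarrow> real" where
  "inner_Om f g = (LINT x:Om|lebesgue. f x * g x)"

definition Lp_norm :: "real \<Rightarrow> real set \<Rightarrow> (real \<Rightarrow> real) \<Rightarrow> real" where
  "Lp_norm p R f = (LINT x:R|lebesgue. \<bar>f x\<bar> powr p) powr (1 / p)"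

definition atoms :: "'a set set \<Rightarrow> 'a set set" where
  "atoms F = {A \<in> F. A \<noteq> {} \<and> (\<forall>B\<in>F. B \<subseteq> A \<longrightarrow> B = {} \<or> B = A)}"

text \<open>
  \<open>F n\<close> is the n-th sigma-algebra. For \<open>n \<ge> 1\<close>, \<open>D n\<close> is the atom of \<open>F (n - 1)\<close> that is
  subdivided, \<open>D' n\<close> is its smaller and \<open>D'' n\<close> its larger part; the values at \<open>0\<close> of \<open>D\<close>,
  \<open>D'\<close>, \<open>D''\<close> are irrelevant.
\<close>

definition binary_filtration ::
  "(nat \<Rightarrow> real set set) \<Rightarrow> (nat \<Rightarrow> real set) \<Rightarrow> (nat \<Rightarrow> real set) \<Rightarrow> (nat \<Rightarrow> real set) \<Rightarrow> bool"
  where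
  "binary_filtration F D D' D'' \<longleftrightarrow>
     F 0 = {{}, Om} \<and>
     (\<forall>n\<ge>1.
        D n \<in> atoms (F (n - 1)) \<and>
        D' n \<in> sets lebesgue \<and> D'' n \<in> sets lebesgue \<and>
        D' n \<union> D'' n = D n \<and> D' n \<inter> D'' n = {} \<and>
        vol (D'' n) \<ge> vol (D' n) \<and> vol (D' n) > 0 \<and>
        F n = sigma_sets Om (F (n - 1) \<union> {D' n, D'' n}))"

definition all_atoms :: "(nat \<Rightarrow> 'a set set) \<Rightarrow> 'a set set" where
  "all_atoms F = (\<Union>n. atoms (F n))"

definition rings :: "(nat \<Rightarrow> 'a set set) \<Rightarrow> 'a set set" where
  "rings F = {A - B | A B. A \<in> all_atoms F \<and> B \<in> all_atoms F \<and> B \<subset> A}"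

definition atom_chain ::
  "(nat \<Rightarrow> real set set) \<Rightarrow> (nat \<Rightarrow> real set) \<Rightarrow> (nat \<Rightarrow> real set) \<Rightarrow> (nat \<Rightarrow> real set)
     \<Rightarrow> nat \<Rightarrow> (nat \<Rightarrow> real set) \<Rightarrow> bool" where
  "atom_chain F D D' D'' n X \<longleftrightarrow>
     (\<forall>j\<le>n. X j \<in> all_atoms F) \<and>
     (\<forall>j<n. \<exists>m\<ge>1. X j = D m \<and> X (Suc j) \<in> {D' m, D'' m})"

text \<open>
  The conditions determine \<open>\<phi> n\<close>, \<open>n \<ge> 1\<close>, only up to its sign. Index \<open>0\<close> belongs to the
  constant function, and index \<open>n \<ge> 1\<close> to the atom \<open>D n\<close>.
\<close>

definition haar_system ::
  "(nat \<Rightarrow> real set) \<Rightarrow> (nat \<Rightarrow> real set) \<Rightarrow> (nat \<Rightarrow> real set) \<Rightarrow> (nat \<Rightarrow> real \<Rightarrow> real) \<Rightarrow> bool"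
  where
  "haar_system D D' D'' \<phi> \<longleftrightarrow>
     \<phi> 0 = indicator Om \<and>
     (\<forall>n\<ge>1.
        (\<forall>x. x \<notin> D n \<longrightarrow> \<phi> n x = 0) \<and>
        (\<exists>a. \<forall>x\<in>D' n. \<phi> n x = a) \<and>
        (\<exists>b. \<forall>x\<in>D'' n. \<phi> n x = b) \<and>
        (LINT x:Om|lebesgue. \<phi> n x) = 0 \<and>
        (LINT x:Om|lebesgue. (\<phi> n x)\<^sup>2) = 1)"

definition haar_support :: "(nat \<Rightarrow> real \<Rightarrow> real) \<Rightarrow> (real \<Rightarrow> real) \<Rightarrow> nat set" where
  "haar_support \<phi> f = {l. inner_Om f (\<phi> l) \<noteq> 0}"

definition haar_sum ::
  "(nat \<Rightarrow> real \<Rightarrow> real) \<Rightarrow> (real \<Rightarrow> real) \<Rightarrow> nat set \<Rightarrow> real \<Rightarrow> real" where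
  "haar_sum \<phi> f G x = (\<Sum>l\<in>G. inner_Om f (\<phi> l) * \<phi> l x)"

definition E_const :: "real \<Rightarrow> (real \<Rightarrow> real) \<Rightarrow> real set \<Rightarrow> real" where
  "E_const p f R = (INF c. Lp_norm p R (\<lambda>x. f x - c))"

definition V_seminorm ::
  "(nat \<Rightarrow> real set set) \<Rightarrow> real \<Rightarrow> real \<Rightarrow> (real \<Rightarrow> real) \<Rightarrow> ereal" where
  "V_seminorm F \<sigma> p f =
     (SUP P \<in> {P. finite P \<and> P \<subseteq> all_atoms F \<union> rings F \<and> disjoint P}.
        ereal ((\<Sum>R\<in>P. E_const p f R powr \<sigma>) powr (1 / \<sigma>)))"

definition V_norm ::
  "(nat \<Rightarrow> real set set) \<Rightarrow> real \<Rightarrow> real \<Rightarrow> (real \<Rightarrow> real) \<Rightarrow> ereal" where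
  "V_norm F \<sigma> p f = ereal (Lp_norm p Om f) + V_seminorm F \<sigma> p f"

definition chain_part :: "(nat \<Rightarrow> 'a set) \<Rightarrow> nat set \<Rightarrow> 'a set" where
  "chain_part X J = (\<Union>j\<in>J. X j - X (Suc j))"

text \<open>
  A partition of \<open>{0,\<dots>,n-1}\<close> into \<open>k\<close> (nonempty) sets of consecutive indices is given by its
  break points \<open>0 = lam 0 < \<dots> < lam k = n\<close>.
\<close>

definition w3 ::
  "(nat \<Rightarrow> real set set) \<Rightarrow> (nat \<Rightarrow> real set) \<Rightarrow> (nat \<Rightarrow> real set) \<Rightarrow> (nat \<Rightarrow> real set)
     \<Rightarrow> real \<Rightarrow> real \<Rightarrow> bool" where
  "w3 F D D' D'' p \<sigma> \<longleftrightarrow>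
     (\<exists>\<rho> M. 0 < \<rho> \<and> \<rho> < 1 \<and> M > 0 \<and>
       (\<forall>n X. atom_chain F D D' D'' n X \<and> vol (X n) \<ge> \<rho> * vol (X 0) \<longrightarrow>
         (\<forall>k lam \<Gamma>.
            lam 0 = 0 \<and> lam k = n \<and> (\<forall>i<k. lam i < lam (Suc i)) \<and>
            (\<forall>i<k. \<Gamma> i \<subseteq> {lam i..<lam (Suc i)}) \<longrightarrow>
            (let R = (\<lambda>i. chain_part X {lam i..<lam (Suc i)});
                 Q = (\<lambda>i. chain_part X (\<Gamma> i))
             in (\<Sum>i<k. min (vol (Q i)) (vol (R i - Q i)) powr (\<sigma> / p)) powr (1 / \<sigma>)
                  \<le> M * vol (X 0 - X n) powr (1 / p)))))"

end

theory Submission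
  imports Defs
begin

text \<open>
  Let \<open>X 0 \<supset> \<dots> \<supset> X n\<close> be a chain with \<open>vol (X n) \<ge> 1/2 * vol (X 0)\<close> that violates the
  inequality in \<open>w3\<close> with constant \<open>N\<close>, let \<open>v = vol (X 0 - X n)\<close>, and let \<open>f\<close> be \<open>1\<close> on
  \<open>X 0 - X n\<close>, \<open>- v / vol (X n)\<close> on \<open>X n\<close> and \<open>0\<close> elsewhere. The key is that the Haar
  expansion of \<open>f\<close> is the telescoping sum of
    \<open>h j = vol (X 0) * (indicator (X j) / vol (X j) - indicator (X (Suc j)) / vol (X (Suc j)))\<close>
  over \<open>j < n\<close>. Each \<open>h j\<close> has mean zero, lives on \<open>X j\<close> and is constant on both parts of
  \<open>X j\<close>, so it is a nonzero multiple of the Haar function of \<open>X j\<close>. Orthonormality then shows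
  that the Haar support of \<open>f\<close> is exactly the set of indices of \<open>X 0, \<dots>, X (n - 1)\<close>, and that
  the partial Haar sums of \<open>f\<close> are the partial sums of the \<open>h j\<close>
  (\<open>density_gap_eq_haar\<close>, \<open>chain_haar_support\<close>).

  The variation norm of \<open>f\<close> is small because \<open>f\<close> takes only three values, on nested sets: among
  pairwise disjoint atoms and rings at most three see more than one value (\<open>card_nonconstant\<close>),
  and each of them contributes at most the \<open>L\<^sup>p\<close> norm of \<open>f\<close>, which is of order \<open>v powr (1/p)\<close>
  since \<open>X n\<close> fills at least half of \<open>X 0\<close> (\<open>V_norm_two_step_le\<close>).

  For the partial sum, keep the terms with \<open>j\<close> in the union \<open>G\<close> of the sets \<open>\<Gamma> i\<close> of the
  violated inequality. On \<open>X l - X (Suc l)\<close> this sum is at least \<open>1\<close> if \<open>l \<in> G\<close> and at most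
  \<open>0\<close> otherwise (\<open>partial_sum_chain_haar\<close>). So on each ring \<open>R i\<close> it jumps by at least \<open>1\<close>
  between \<open>Q i\<close> and \<open>R i - Q i\<close>, whence its distance to the constants in \<open>L\<^sup>p\<close> of \<open>R i\<close> is at least
  half the \<open>p\<close>-th root of \<open>min (vol (Q i)) (vol (R i - Q i))\<close>. The rings \<open>R i\<close> are disjoint, and
  summing over them gives at least half of the left-hand side of the violated inequality
  (\<open>V_seminorm_partial_sum_ge\<close>).
\<close>

section \<open>The atoms of a binary filtration\<close>

lemma atoms_Union_Pow:
  assumes P: "partition_on U P"
  shows "atoms (Union ` Pow P) = P"
proof (intro equalityI subsetI)
  fix A assume "A \<in> atoms (Union ` Pow P)"
  note * = this[unfolded atoms_def mem_Collect_eq]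
  note A = *[THEN conjunct1] *[THEN conjunct2, THEN conjunct1]
    and min = *[THEN conjunct2, THEN conjunct2]
  from A(1) obtain S where S: "A = \<Union>S" "S \<subseteq> P" by (elim imageE PowD) auto
  from A(2) obtain B where B: "B \<in> S" "B \<noteq> {}" unfolding S(1) by auto
  then have "B \<in> Union ` Pow P" "B \<subseteq> A" using S by (auto intro!: image_eqI[of _ _ "{B}"])
  then have "B = A" using bspec[OF min] B(2) by blast
  then show "A \<in> P" using B(1) S(2) by auto
next
  fix A assume A: "A \<in> P"
  have ne: "A \<noteq> {}" using P A by (metis partition_onD3)
  have mem: "A \<in> Union ` Pow P" using A by (intro image_eqI[of _ _ "{A}"]) auto
  have "B = {} \<or> B = A" if "B \<in> Union ` Pow P" "B \<subseteq> A" for B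
  proof -
    from that obtain S where S: "S \<subseteq> P" "B = \<Union>S" by blast
    have "C = A" if "C \<in> S" for C
    proof -
      have "C \<in> P" "C \<subseteq> A" "C \<noteq> {}"
        using that S \<open>B \<subseteq> A\<close> P by (auto simp: partition_on_def)
      then show ?thesis
        using disjointD[OF partition_onD2[OF P], of C A] A by blast
    qed
    then have "S \<subseteq> {A}" by blast
    then show ?thesis using S by blast
  qed
  then have "\<forall>B \<in> Union ` Pow P. B \<subseteq> A \<longrightarrow> B = {} \<or> B = A" by blast
  with ne mem show "A \<in> atoms (Union ` Pow P)"
    unfolding atoms_def mem_Collect_eq by (intro conjI)
qed

lemma sigma_sets_finite_partition:
  assumes P: "partition_on U P" and fin: "finite P"
  shows "sigma_sets U P = Union ` Pow P"
proof (intro equalityI subsetI)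
  fix A assume "A \<in> sigma_sets U P"
  then show "A \<in> Union ` Pow P"
  proof induction
    case (Basic A) then show ?case by (intro image_eqI[of _ _ "{A}"]) auto
  next
    case Empty show ?case by (intro image_eqI[of _ _ "{}"]) auto
  next
    case (Compl A)
    then obtain S where S: "S \<subseteq> P" "A = \<Union>S" by blast
    have "U - A = \<Union>(P - S)"
      using S partition_onD1[OF P] disjointD[OF partition_onD2[OF P]] by blast
    then show ?case by blast
  next
    case (Union A)
    have "\<exists>S. S \<subseteq> P \<and> A i = \<Union>S" for i using Union.IH[of i] by (elim imageE) auto
    then obtain S where "\<And>i. S i \<subseteq> P" "\<And>i. A i = \<Union>(S i)" by metis
    then have "(\<Union>i. A i) = \<Union>(\<Union>i. S i)" "(\<Union>i. S i) \<subseteq> P" by auto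
    then show ?case by blast
  qed
next
  fix A assume "A \<in> Union ` Pow P"
  then obtain S where S: "S \<subseteq> P" "A = \<Union>S" by blast
  then have "countable S" using fin finite_subset uncountable_infinite by blast
  then show "A \<in> sigma_sets U P"
    unfolding S(2) using S(1)
    by (intro sigma_sets_UNION) (auto intro: sigma_sets.Basic)
qed

lemma partition_on_split:
  assumes P: "partition_on U P" and A: "A \<in> P" "B \<union> C = A" "B \<inter> C = {}" "B \<noteq> {}" "C \<noteq> {}"
  shows "partition_on U (P - {A} \<union> {B, C})"
proof (rule partition_onI)
  show "\<Union>(P - {A} \<union> {B, C}) = U"
    using partition_onD1[OF P] A by auto
  show "disjnt X Y" if "X \<in> P - {A} \<union> {B, C}" "Y \<in> P - {A} \<union> {B, C}" "X \<noteq> Y" for X Y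
  proof -
    have d: "disjnt Z B" "disjnt Z C" if "Z \<in> P - {A}" for Z
      using disjointD[OF partition_onD2[OF P], of Z A] that A unfolding disjnt_def by blast+
    have e: "disjnt X Y" if "X \<in> P - {A}" "Y \<in> P - {A}"
      using disjointD[OF partition_onD2[OF P], of X Y] that \<open>X \<noteq> Y\<close>
      unfolding disjnt_def by blast
    have "disjnt B C" using A(3) by (simp add: disjnt_def)
    then show ?thesis using that d e by (metis Un_iff disjnt_sym empty_iff insert_iff)
  qed
  show "{} \<notin> P - {A} \<union> {B, C}"
    using A partition_onD3[OF P] by auto
qed

lemma sigma_sets_split_atom:
  assumes P: "partition_on U P" and fin: "finite P"
    and A: "A \<in> P" "B \<union> C = A" "B \<inter> C = {}" "B \<noteq> {}" "C \<noteq> {}"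
  shows "sigma_sets U (Union ` Pow P \<union> {B, C}) = Union ` Pow (P - {A} \<union> {B, C})"
proof -
  let ?P' = "P - {A} \<union> {B, C}"
  have P': "partition_on U ?P'" "finite ?P'"
    using partition_on_split[OF P A] fin by auto
  have "sigma_sets U (Union ` Pow P \<union> {B, C}) = sigma_sets U ?P'"
  proof (rule sigma_sets_eqI)
    fix X assume "X \<in> Union ` Pow P \<union> {B, C}"
    then consider S where "S \<subseteq> P" "X = \<Union>S" | "X \<in> {B, C}" by blast
    then show "X \<in> sigma_sets U ?P'"
    proof cases
      case 1
      let ?T = "if A \<in> S then S - {A} \<union> {B, C} else S"
      have "X = \<Union>?T" "?T \<subseteq> ?P'" using 1 A(2) by auto
      then show ?thesis unfolding sigma_sets_finite_partition[OF P'] by blast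
    qed (auto intro: sigma_sets.Basic)
  next
    fix X assume "X \<in> ?P'"
    moreover have "Y \<in> Union ` Pow P" if "Y \<in> P" for Y
      using that by (intro image_eqI[of _ _ "{Y}"]) auto
    ultimately show "X \<in> sigma_sets U (Union ` Pow P \<union> {B, C})"
      by (intro sigma_sets.Basic) auto
  qed
  then show ?thesis using sigma_sets_finite_partition[OF P'] by simp
qed

locale haar_filtration =
  fixes F :: "nat \<Rightarrow> real set set" and D D' D'' :: "nat \<Rightarrow> real set"
  assumes filtration: "binary_filtration F D D' D''"
begin

lemma split_facts:
  assumes "m \<ge> 1"
  shows D_atom: "D m \<in> atoms (F (m - 1))"
    and D'_sets: "D' m \<in> sets lebesgue" and D''_sets: "D'' m \<in> sets lebesgue"
    and D_Un: "D' m \<union> D'' m = D m" and D_Int: "D' m \<inter> D'' m = {}"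
    and D'_pos: "vol (D' m) > 0" and D''_pos: "vol (D'' m) > 0"
proof -
  note * = filtration[unfolded binary_filtration_def, THEN conjunct2, rule_format, OF assms]
  from * show "D m \<in> atoms (F (m - 1))" "D' m \<in> sets lebesgue" "D'' m \<in> sets lebesgue"
    "D' m \<union> D'' m = D m" "D' m \<inter> D'' m = {}" "vol (D' m) > 0" by blast+
  from * show "vol (D'' m) > 0" by linarith
qed

lemma D'_nonempty: "m \<ge> 1 \<Longrightarrow> D' m \<noteq> {}" and D''_nonempty: "m \<ge> 1 \<Longrightarrow> D'' m \<noteq> {}"
  using D'_pos[of m] D''_pos[of m] by auto

lemma atoms_F0: "atoms (F 0) = {Om}" and F0_Union: "F 0 = Union ` Pow {Om}"
proof -
  show F0: "F 0 = Union ` Pow {Om}"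
    using filtration[unfolded binary_filtration_def, THEN conjunct1] by (auto simp: Pow_insert)
  show "atoms (F 0) = {Om}" unfolding F0 by (rule atoms_Union_Pow) (auto simp: partition_on_def)
qed

lemma split_Suc:
  assumes IH: "finite (atoms (F n))" "partition_on Om (atoms (F n))"
    "F n = Union ` Pow (atoms (F n))"
  defines "P' \<equiv> atoms (F n) - {D (Suc n)} \<union> {D' (Suc n), D'' (Suc n)}"
  shows "partition_on Om P'" "F (Suc n) = Union ` Pow P'" "atoms (F (Suc n)) = P'"
proof -
  have A: "D (Suc n) \<in> atoms (F n)" "D' (Suc n) \<union> D'' (Suc n) = D (Suc n)"
    "D' (Suc n) \<inter> D'' (Suc n) = {}" "D' (Suc n) \<noteq> {}" "D'' (Suc n) \<noteq> {}"
    using split_facts[of "Suc n"] D'_nonempty[of "Suc n"] D''_nonempty[of "Suc n"] by auto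
  show P': "partition_on Om P'" unfolding P'_def by (rule partition_on_split[OF IH(2) A])
  have "F (Suc n) = sigma_sets Om (F n \<union> {D' (Suc n), D'' (Suc n)})"
    using filtration[unfolded binary_filtration_def, THEN conjunct2, rule_format, of "Suc n"]
    by simp
  also have "\<dots> = sigma_sets Om (Union ` Pow (atoms (F n)) \<union> {D' (Suc n), D'' (Suc n)})"
    by (subst IH(3)) (rule refl)
  also have "\<dots> = Union ` Pow P'"
    unfolding P'_def by (rule sigma_sets_split_atom[OF IH(2,1) A])
  finally show "F (Suc n) = Union ` Pow P'" .
  then show "atoms (F (Suc n)) = P'" by (simp only: atoms_Union_Pow[OF P'])
qed

text \<open>
  The filtration is given by generated sigma-algebras. Splitting one atom of a finite partition
  keeps it a finite partition, so every \<open>F n\<close> consists of the unions of its atoms, and passing to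
  \<open>F (Suc n)\<close> changes the set of atoms only by that split.
\<close>

lemma atoms_partition:
  "finite (atoms (F n)) \<and> partition_on Om (atoms (F n)) \<and> F n = Union ` Pow (atoms (F n))"
proof (induction n)
  case 0
  show ?case unfolding atoms_F0 using F0_Union by (simp add: partition_on_def)
next
  case (Suc n)
  note step = split_Suc[OF Suc[THEN conjunct1] Suc[THEN conjunct2, THEN conjunct1]
    Suc[THEN conjunct2, THEN conjunct2]]
  have "finite (atoms (F n) - {D (Suc n)} \<union> {D' (Suc n), D'' (Suc n)})"
    using Suc[THEN conjunct1] by simp
  with step(1,2) show ?case unfolding step(3) by (intro conjI)
qed

lemma atoms_Suc:
  "atoms (F (Suc n)) = atoms (F n) - {D (Suc n)} \<union> {D' (Suc n), D'' (Suc n)}"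
proof -
  note * = atoms_partition[of n]
  show ?thesis
    by (rule split_Suc(3)[OF *[THEN conjunct1] *[THEN conjunct2, THEN conjunct1]
      *[THEN conjunct2, THEN conjunct2]])
qed

lemma atom_refines:
  assumes "m \<le> n" "B \<in> atoms (F n)"
  shows "\<exists>A\<in>atoms (F m). B \<subseteq> A"
  using assms
proof (induction arbitrary: B rule: dec_induct)
  case (step n)
  have D: "D (Suc n) \<in> atoms (F n)" "D' (Suc n) \<subseteq> D (Suc n)" "D'' (Suc n) \<subseteq> D (Suc n)"
    using D_atom[of "Suc n"] D_Un[of "Suc n"] by auto
  from step.prems have "B \<in> atoms (F n) \<or> B = D' (Suc n) \<or> B = D'' (Suc n)"
    unfolding atoms_Suc by (elim UnE DiffE insertE) simp_all
  then obtain A where "A \<in> atoms (F n)" "B \<subseteq> A" using D by (metis order_refl)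
  then show ?case using step.IH[of A] by (meson order_trans)
qed auto

lemma atoms_nested:
  assumes "A \<in> all_atoms F" "B \<in> all_atoms F"
  shows "A \<subseteq> B \<or> B \<subseteq> A \<or> A \<inter> B = {}"
proof -
  have *: "B \<subseteq> A \<or> A \<inter> B = {}" if le: "m \<le> n" and A: "A \<in> atoms (F m)" and B: "B \<in> atoms (F n)" for A B m n
  proof -
    from le B atom_refines obtain A' where A': "A' \<in> atoms (F m)" "B \<subseteq> A'" by metis
    have "disjoint (atoms (F m))"
      by (rule partition_onD2[OF atoms_partition[THEN conjunct2, THEN conjunct1]])
    from disjointD[OF this A A'(1)] have "A = A' \<or> A \<inter> A' = {}" by blast
    then show ?thesis using A'(2) by blast
  qed
  obtain m n where "A \<in> atoms (F m)" "B \<in> atoms (F n)"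
    using assms by (auto simp: all_atoms_def)
  then show ?thesis using *[of m n A B] *[of n m B A] by (cases "m \<le> n") auto
qed

lemma atom_facts:
  assumes "A \<in> all_atoms F"
  shows atom_sets: "A \<in> sets lebesgue" and atom_pos: "vol A > 0" and atom_subset: "A \<subseteq> Om"
proof -
  obtain n where n: "A \<in> atoms (F n)" using assms by (auto simp: all_atoms_def)
  have "A \<in> sets lebesgue \<and> vol A > 0"
    using n
  proof (induction n arbitrary: A)
    case 0
    then show ?case unfolding atoms_F0 by simp
  next
    case (Suc n)
    then show ?case unfolding atoms_Suc
      using D'_sets[of "Suc n"] D''_sets[of "Suc n"] D'_pos[of "Suc n"] D''_pos[of "Suc n"] by auto
  qed
  then show "A \<in> sets lebesgue" "vol A > 0" by auto
  have "Om = \<Union>(atoms (F n))"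
    by (rule partition_onD1[OF atoms_partition[THEN conjunct2, THEN conjunct1]])
  with n show "A \<subseteq> Om" by (metis Union_upper)
qed

lemma atom_lmeasurable:
  assumes "A \<in> all_atoms F" shows "A \<in> lmeasurable"
proof (rule bounded_set_imp_lmeasurable)
  have "A \<subseteq> {0..1}" using atom_subset[OF assms] by auto
  then show "bounded A" by (rule bounded_subset[OF bounded_closed_interval])
qed (rule atom_sets[OF assms])

lemma Om_lmeasurable: "Om \<in> lmeasurable"
  using atom_lmeasurable[of Om] atoms_F0 by (auto simp: all_atoms_def)

end

section \<open>Integrals of step functions\<close>

lemma set_integrable_bounded:
  fixes h :: "real \<Rightarrow> real"
  assumes "A \<in> lmeasurable" "h \<in> borel_measurable lebesgue" "\<And>x. x \<in> A \<Longrightarrow> \<bar>h x\<bar> \<le> K"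
  shows "set_integrable lebesgue A h"
  unfolding set_integrable_def
  using assms fmeasurableD[OF assms(1)] fmeasurableD2[OF assms(1)]
  by (intro integrableI_bounded_set_indicator[where B = K]) (auto simp: top.not_eq_extremum)

lemma set_integral_step:
  assumes "R \<in> lmeasurable" "A \<in> sets lebesgue" "B \<in> sets lebesgue"
  shows "(LINT x:R|lebesgue. a * indicator A x + b * indicator B x)
    = a * vol (R \<inter> A) + b * vol (R \<inter> B)"
proof -
  have int: "set_integrable lebesgue R (indicator C :: real \<Rightarrow> real)" if "C \<in> sets lebesgue" for C
    using assms(1) that by (intro set_integrable_bounded[where K = 1]) (auto split: split_indicator)
  have "(LINT x:R|lebesgue. indicator C x :: real) = vol (R \<inter> C)" for C
  proof -
    have "(\<lambda>x. indicator R x *\<^sub>R (indicator C x :: real)) = indicator (R \<inter> C)"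
      by (auto split: split_indicator)
    then show ?thesis unfolding set_lebesgue_integral_def by simp
  qed
  then show ?thesis using int[OF assms(2)] int[OF assms(3)] by (simp add: set_integral_add)
qed

section \<open>Haar functions and densities\<close>

definition density_gap :: "real set \<Rightarrow> real set \<Rightarrow> real \<Rightarrow> real" where
  "density_gap A B x = indicator A x / vol A - indicator B x / vol B"

lemma abs_density_gap_le: "\<bar>density_gap A B x\<bar> \<le> 1 / vol A + 1 / vol B"
  unfolding density_gap_def
  by (intro order_trans[OF abs_triangle_ineq4] add_mono) (auto split: split_indicator)

lemma density_gap_measurable:
  "A \<in> sets lebesgue \<Longrightarrow> B \<in> sets lebesgue \<Longrightarrow> density_gap A B \<in> borel_measurable lebesgue"
  unfolding density_gap_def[abs_def]
  by (intro borel_measurable_diff borel_measurable_divide borel_measurable_const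
      borel_measurable_indicator)

locale haar_basis = haar_filtration +
  fixes \<phi> :: "nat \<Rightarrow> real \<Rightarrow> real"
  assumes haar: "haar_system D D' D'' \<phi>"
begin

lemma haar_0: "\<phi> 0 = indicator Om"
  using haar unfolding haar_system_def by blast

lemma haar_facts:
  assumes "m \<ge> 1"
  shows haar_outside: "x \<notin> D m \<Longrightarrow> \<phi> m x = 0"
    and haar_const': "\<exists>a. \<forall>x\<in>D' m. \<phi> m x = a"
    and haar_const'': "\<exists>b. \<forall>x\<in>D'' m. \<phi> m x = b"
    and haar_mean: "(LINT x:Om|lebesgue. \<phi> m x) = 0"
    and haar_norm: "(LINT x:Om|lebesgue. (\<phi> m x)\<^sup>2) = 1"
proof -
  note * = haar[unfolded haar_system_def, THEN conjunct2, rule_format, OF assms]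
  show "x \<notin> D m \<Longrightarrow> \<phi> m x = 0" using *[THEN conjunct1] by blast
  show "\<exists>a. \<forall>x\<in>D' m. \<phi> m x = a" by (rule *[THEN conjunct2, THEN conjunct1])
  show "\<exists>b. \<forall>x\<in>D'' m. \<phi> m x = b" by (rule *[THEN conjunct2, THEN conjunct2, THEN conjunct1])
  from * show "(LINT x:Om|lebesgue. \<phi> m x) = 0" "(LINT x:Om|lebesgue. (\<phi> m x)\<^sup>2) = 1"
    by simp_all
qed

lemma D_subset: assumes "m \<ge> 1" shows "D m \<subseteq> Om"
proof (rule atom_subset)
  show "D m \<in> all_atoms F" using D_atom[OF assms] unfolding all_atoms_def by (rule UN_I[OF UNIV_I])
qed

lemma haar_eq_density_gap:
  assumes "m \<ge> 1"
  obtains \<kappa> where "\<kappa> \<noteq> 0" "\<phi> m = (\<lambda>x. \<kappa> * density_gap (D' m) (D'' m) x)"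
proof -
  obtain a where a: "\<forall>x\<in>D' m. \<phi> m x = a" using haar_const'[OF assms] ..
  obtain b where b: "\<forall>x\<in>D'' m. \<phi> m x = b" using haar_const''[OF assms] ..
  have step: "\<phi> m x = a * indicator (D' m) x + b * indicator (D'' m) x" for x
    using a b haar_outside[OF assms, of x] D_Un[OF assms] D_Int[OF assms]
    by (auto split: split_indicator)
  have sub: "Om \<inter> D' m = D' m" "Om \<inter> D'' m = D'' m"
    using D_subset[OF assms] D_Un[OF assms] by auto
  have "0 = (LINT x:Om|lebesgue. a * indicator (D' m) x + b * indicator (D'' m) x)"
    using haar_mean[OF assms] unfolding step by simp
  also have "\<dots> = a * vol (D' m) + b * vol (D'' m)"
    using set_integral_step[OF Om_lmeasurable D'_sets[OF assms] D''_sets[OF assms], of a b]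
    unfolding sub .
  finally have mean: "a * vol (D' m) + b * vol (D'' m) = 0" by simp
  have b_eq: "b = - (a * vol (D' m)) / vol (D'' m)"
    using mean D''_pos[OF assms] by (simp add: field_simps)
  have eq: "\<phi> m = (\<lambda>x. (a * vol (D' m)) * density_gap (D' m) (D'' m) x)"
  proof
    fix x
    show "\<phi> m x = (a * vol (D' m)) * density_gap (D' m) (D'' m) x"
      using D'_pos[OF assms] D''_pos[OF assms] unfolding step b_eq density_gap_def
      by (simp add: field_simps)
  qed
  have "a * vol (D' m) \<noteq> 0"
  proof
    assume "a * vol (D' m) = 0"
    then have "\<phi> m = (\<lambda>x. 0)" unfolding eq by (simp only: mult_zero_left)
    then show False using haar_norm[OF assms] by simp
  qed
  then show ?thesis using that eq by blast
qed

text \<open>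
  The functions supported in \<open>D m\<close> that have mean zero and are constant on both parts of \<open>D m\<close>
  form a line, so every density gap across the split of \<open>D m\<close> is a multiple of \<open>\<phi> m\<close>.
\<close>

lemma density_gap_eq_haar:
  assumes m: "m \<ge> 1" and Y: "Y \<in> {D' m, D'' m}"
  obtains a where "a \<noteq> 0" "\<And>x. density_gap (D m) Y x = a * \<phi> m x"
proof -
  obtain \<kappa> where \<kappa>: "\<kappa> \<noteq> 0" "\<phi> m = (\<lambda>x. \<kappa> * density_gap (D' m) (D'' m) x)"
    by (rule haar_eq_density_gap[OF m])
  have pos: "vol (D' m) > 0" "vol (D'' m) > 0" using D'_pos[OF m] D''_pos[OF m] .
  have fin: "emeasure lebesgue (D' m) \<noteq> \<infinity>" "emeasure lebesgue (D'' m) \<noteq> \<infinity>"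
    using pos by (auto simp: measure_def)
  have vol: "vol (D m) = vol (D' m) + vol (D'' m)"
    using measure_Union[OF fin D'_sets[OF m] D''_sets[OF m] D_Int[OF m]] D_Un[OF m] by simp
  have ind: "indicator (D m) x = indicator (D' m) x + (indicator (D'' m) x :: real)" for x
    using D_Un[OF m] D_Int[OF m] by (auto split: split_indicator)
  let ?u = "density_gap (D' m) (D'' m)"
  have gap': "density_gap (D m) (D' m) x = (- vol (D'' m) / vol (D m)) * ?u x" for x
    unfolding density_gap_def ind vol using pos by (simp add: divide_simps) (simp add: algebra_simps)
  have gap'': "density_gap (D m) (D'' m) x = (vol (D' m) / vol (D m)) * ?u x" for x
    unfolding density_gap_def ind vol using pos by (simp add: divide_simps) (simp add: algebra_simps)
  define t where "t = (if Y = D' m then - vol (D'' m) / vol (D m) else vol (D' m) / vol (D m))"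
  have "t \<noteq> 0" using pos vol by (auto simp: t_def)
  moreover have "density_gap (D m) Y x = t * ?u x" for x
    using Y gap' gap'' by (auto simp: t_def)
  ultimately show ?thesis
    using that[of "t / \<kappa>"] \<kappa> by simp
qed

text \<open>
  A Haar function of index \<open>l\<close> is \<open>F l\<close>-measurable. Since a later split happens inside an atom of
  \<open>F l\<close>, the product with a later Haar function is a constant multiple of the latter, whose mean
  vanishes.
\<close>

lemma haar_constant_on_atoms:
  assumes "A \<in> atoms (F l)"
  shows "\<exists>c. \<forall>x\<in>A. \<phi> l x = c"
proof (cases l)
  case 0
  then show ?thesis using assms atoms_F0 haar_0 by auto
next
  case (Suc k)
  have l: "l \<ge> 1" using Suc by simp
  consider "A = D' l" | "A = D'' l" | "A \<in> atoms (F k)" "A \<noteq> D l"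
    using assms unfolding Suc atoms_Suc by (elim UnE DiffE insertE) simp_all
  then show ?thesis
  proof cases
    case 3
    have "D l \<in> atoms (F k)" using D_atom[OF l] Suc by simp
    with 3 have "A \<inter> D l = {}"
      by (intro disjointD[OF partition_onD2[OF atoms_partition[THEN conjunct2, THEN conjunct1]]])
    then have "\<forall>x\<in>A. \<phi> l x = 0" using haar_outside[OF l] by blast
    then show ?thesis ..
  qed (use haar_const'[OF l] haar_const''[OF l] in simp_all)
qed

lemma haar_bounded_measurable:
  "\<phi> l \<in> borel_measurable lebesgue \<and> (\<exists>K. \<forall>x. \<bar>\<phi> l x\<bar> \<le> K)"
proof (cases "l = 0")
  case True
  have "\<forall>x. \<bar>indicator Om x :: real\<bar> \<le> 1" by (auto split: split_indicator)
  moreover have "(indicator Om :: real \<Rightarrow> real) \<in> borel_measurable lebesgue"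
    using Om_lmeasurable by (intro borel_measurable_indicator fmeasurableD)
  ultimately show ?thesis unfolding True haar_0 by blast
next
  case False
  then have l: "l \<ge> 1" by simp
  obtain \<kappa> where \<kappa>: "\<phi> l = (\<lambda>x. \<kappa> * density_gap (D' l) (D'' l) x)"
    by (rule haar_eq_density_gap[OF l])
  have "\<phi> l \<in> borel_measurable lebesgue"
    unfolding \<kappa> using density_gap_measurable[OF D'_sets[OF l] D''_sets[OF l]] by simp
  moreover have "\<bar>\<phi> l x\<bar> \<le> \<bar>\<kappa>\<bar> * (1 / vol (D' l) + 1 / vol (D'' l))" for x
    unfolding \<kappa> abs_mult by (intro mult_left_mono abs_density_gap_le) simp
  ultimately show ?thesis by blast
qed

lemma inner_haar_integrable: "set_integrable lebesgue Om (\<lambda>x. \<phi> l x * \<phi> m x)"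
proof -
  obtain K L where KL: "\<And>x. \<bar>\<phi> l x\<bar> \<le> K" "\<And>x. \<bar>\<phi> m x\<bar> \<le> L"
    using haar_bounded_measurable by metis
  have "\<bar>\<phi> l x * \<phi> m x\<bar> \<le> K * L" for x
    unfolding abs_mult using KL[of x] by (intro mult_mono) auto
  then show ?thesis
    using haar_bounded_measurable Om_lmeasurable
    by (intro set_integrable_bounded[where K = "K * L"] borel_measurable_times) auto
qed

lemma haar_orthogonal:
  assumes "l < m"
  shows "inner_Om (\<phi> l) (\<phi> m) = 0"
proof -
  have m: "m \<ge> 1" "l \<le> m - 1" using assms by auto
  obtain A where A: "A \<in> atoms (F l)" "D m \<subseteq> A"
    using atom_refines[OF m(2) D_atom[OF m(1)]] by metis
  obtain c where "\<forall>x\<in>A. \<phi> l x = c" using haar_constant_on_atoms[OF A(1)] ..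
  then have "\<phi> l x * \<phi> m x = c * \<phi> m x" for x
    using A(2) haar_outside[OF m(1), of x] by (cases "x \<in> D m") auto
  then have "inner_Om (\<phi> l) (\<phi> m) = (LINT x:Om|lebesgue. c * \<phi> m x)"
    unfolding inner_Om_def by (simp only:)
  then show ?thesis using haar_mean[OF m(1)] by simp
qed

lemma haar_orthonormal:
  assumes "m \<ge> 1"
  shows "inner_Om (\<phi> m) (\<phi> l) = (if m = l then 1 else 0)"
proof -
  have "inner_Om (\<phi> m) (\<phi> l) = inner_Om (\<phi> l) (\<phi> m)"
    unfolding inner_Om_def by (simp add: mult.commute)
  moreover have "inner_Om (\<phi> m) (\<phi> m) = 1"
    unfolding inner_Om_def using haar_norm[OF assms] by (simp add: power2_eq_square)
  ultimately show ?thesis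
    using haar_orthogonal[of l m] haar_orthogonal[of m l] by (cases l m rule: linorder_cases) auto
qed

lemma inner_haar_expansion:
  assumes "finite J" "\<And>j. j \<in> J \<Longrightarrow> m j \<ge> 1"
  shows "inner_Om (\<lambda>x. \<Sum>j\<in>J. a j * \<phi> (m j) x) (\<phi> l) = (\<Sum>j\<in>J. if m j = l then a j else 0)"
proof -
  have "inner_Om (\<lambda>x. \<Sum>j\<in>J. a j * \<phi> (m j) x) (\<phi> l)
      = (LINT x:Om|lebesgue. \<Sum>j\<in>J. a j * (\<phi> (m j) x * \<phi> l x))"
    unfolding inner_Om_def by (simp add: sum_distrib_right mult.assoc)
  also have "\<dots> = (\<Sum>j\<in>J. LINT x:Om|lebesgue. a j * (\<phi> (m j) x * \<phi> l x))"
    unfolding set_lebesgue_integral_def scaleR_sum_right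
    using inner_haar_integrable
    by (intro Bochner_Integration.integral_sum) (simp add: set_integrable_def mult.left_commute)
  also have "\<dots> = (\<Sum>j\<in>J. a j * inner_Om (\<phi> (m j)) (\<phi> l))"
    unfolding inner_Om_def by simp
  also have "\<dots> = (\<Sum>j\<in>J. if m j = l then a j else 0)"
    using haar_orthonormal assms(2) by (intro sum.cong) auto
  finally show ?thesis .
qed

end

section \<open>Chains of atoms\<close>

lemma first_exit:
  fixes X :: "nat \<Rightarrow> 'a set"
  assumes "i < j" "x \<in> X i" "x \<notin> X j"
  obtains l where "i \<le> l" "l < j" "x \<in> X l" "x \<notin> X (Suc l)"
proof -
  define l where "l = (LEAST l. i < l \<and> x \<notin> X l)"
  have l: "i < l" "x \<notin> X l" "l \<le> j"
    using LeastI[of "\<lambda>l. i < l \<and> x \<notin> X l" j] Least_le[of "\<lambda>l. i < l \<and> x \<notin> X l" j] assms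
    unfolding l_def by auto
  have "x \<in> X (l - 1)"
  proof (cases "l - 1 = i")
    case False
    then show ?thesis
      using not_less_Least[of "l - 1" "\<lambda>l. i < l \<and> x \<notin> X l"] l(1) unfolding l_def[symmetric] by auto
  qed (use assms in simp)
  then show ?thesis using that[of "l - 1"] l by auto
qed

context haar_filtration
begin

lemma chain_step:
  assumes "atom_chain F D D' D'' n X" "j < n"
  obtains m where "m \<ge> 1" "X j = D m" "X (Suc j) \<in> {D' m, D'' m}"
  using assms unfolding atom_chain_def by blast

lemma chain_atom: "atom_chain F D D' D'' n X \<Longrightarrow> j \<le> n \<Longrightarrow> X j \<in> all_atoms F"
  unfolding atom_chain_def by blast

lemma chain_Suc_subset:
  assumes "atom_chain F D D' D'' n X" "j < n"
  shows "X (Suc j) \<subset> X j"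
proof -
  obtain m where m: "m \<ge> 1" "X j = D m" "X (Suc j) \<in> {D' m, D'' m}"
    by (rule chain_step[OF assms])
  have "D' m \<subset> D m" "D'' m \<subset> D m"
    using D_Un[OF m(1)] D_Int[OF m(1)] D'_nonempty[OF m(1)] D''_nonempty[OF m(1)] by blast+
  then show ?thesis using m by auto
qed

lemma chain_mono:
  assumes "atom_chain F D D' D'' n X" "i \<le> j" "j \<le> n"
  shows "X j \<subseteq> X i"
  using assms(2,3)
proof (induction j rule: dec_induct)
  case (step j)
  then show ?case using chain_Suc_subset[OF assms(1), of j] by auto
qed simp

lemma chain_strict:
  assumes "atom_chain F D D' D'' n X" "i < j" "j \<le> n"
  shows "X j \<subset> X i"
  using chain_Suc_subset[OF assms(1), of i] chain_mono[OF assms(1), of "Suc i" j] assms(2,3) by auto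

lemma chain_part_interval:
  assumes "atom_chain F D D' D'' n X" "a < b" "b \<le> n"
  shows "chain_part X {a..<b} = X a - X b"
proof (intro equalityI subsetI)
  fix x assume "x \<in> chain_part X {a..<b}"
  then obtain j where "a \<le> j" "j < b" "x \<in> X j" "x \<notin> X (Suc j)"
    unfolding chain_part_def by auto
  then show "x \<in> X a - X b"
    using chain_mono[OF assms(1), of a j] chain_mono[OF assms(1), of "Suc j" b] assms(3) by auto
next
  fix x assume "x \<in> X a - X b"
  then obtain l where "a \<le> l" "l < b" "x \<in> X l" "x \<notin> X (Suc l)"
    using first_exit[OF assms(2), of x X] by blast
  then show "x \<in> chain_part X {a..<b}" unfolding chain_part_def by auto
qed

text \<open>
  The term that belongs to the atom \<open>X j\<close> in the Haar expansion of the function of the theorem.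
  The factor \<open>vol (X 0)\<close> is the one for which the terms add up to that function.
\<close>

definition chain_haar :: "(nat \<Rightarrow> real set) \<Rightarrow> nat \<Rightarrow> real \<Rightarrow> real" where
  "chain_haar X j x = vol (X 0) * density_gap (X j) (X (Suc j)) x"

lemma sum_chain_haar:
  assumes "atom_chain F D D' D'' n X"
  shows "(\<Sum>j<n. chain_haar X j x)
    = indicator (X 0 - X n) x - vol (X 0 - X n) / vol (X n) * indicator (X n) x"
proof -
  have X: "X 0 \<in> all_atoms F" "X n \<in> all_atoms F" using chain_atom[OF assms] by auto
  have pos: "vol (X 0) > 0" "vol (X n) > 0" using X atom_pos by auto
  have sub: "X n \<subseteq> X 0" using chain_mono[OF assms] by simp
  have diff: "vol (X 0 - X n) = vol (X 0) - vol (X n)"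
    using measurable_measure_Diff[OF atom_lmeasurable[OF X(1)] atom_sets[OF X(2)] sub] .
  have "(\<Sum>j<n. chain_haar X j x)
      = vol (X 0) * (\<Sum>j<n. indicator (X j) x / vol (X j) - indicator (X (Suc j)) x / vol (X (Suc j)))"
    unfolding chain_haar_def density_gap_def sum_distrib_left ..
  also have "\<dots> = vol (X 0) * (indicator (X 0) x / vol (X 0) - indicator (X n) x / vol (X n))"
    by (simp only: sum_lessThan_telescope'[of "\<lambda>j. indicator (X j) x / vol (X j)" n])
  also have "\<dots> = indicator (X 0 - X n) x - vol (X 0 - X n) / vol (X n) * indicator (X n) x"
    using pos sub unfolding diff by (auto split: split_indicator simp: field_simps)
  finally show ?thesis .
qed

text \<open>
  On \<open>X i - X (Suc i)\<close> the summands with \<open>j < i\<close> are negative and add up, over all \<open>j < i\<close>, to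
  \<open>1 - vol (X 0) / vol (X i)\<close>, the summand with \<open>j = i\<close> is \<open>vol (X 0) / vol (X i)\<close>, and the
  later ones vanish. Deleting terms therefore leaves a value of at least 1 if the term \<open>i\<close> is
  kept and of at most 0 if it is deleted.
\<close>

lemma partial_sum_chain_haar:
  assumes chain: "atom_chain F D D' D'' n X" and G: "G \<subseteq> {..<n}"
    and x: "i < n" "x \<in> X i" "x \<notin> X (Suc i)"
  shows "i \<in> G \<Longrightarrow> (\<Sum>j\<in>G. chain_haar X j x) \<ge> 1"
    and "i \<notin> G \<Longrightarrow> (\<Sum>j\<in>G. chain_haar X j x) \<le> 0"
proof -
  define c where "c j = vol (X 0) / vol (X j)" for j
  have pos: "vol (X j) > 0" if "j \<le> n" for j using atom_pos chain_atom[OF chain that] .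
  have c_mono: "c j \<le> c (Suc j)" if "j < n" for j
  proof -
    have "vol (X (Suc j)) \<le> vol (X j)"
      using that chain_Suc_subset[OF chain that] chain_atom[OF chain]
      by (intro measure_mono_fmeasurable atom_sets atom_lmeasurable) auto
    then show ?thesis unfolding c_def
      using pos[of 0] pos[of j] pos[of "Suc j"] that by (intro divide_left_mono) auto
  qed
  have early: "chain_haar X j x = - (c (Suc j) - c j)" if "j < i" for j
  proof -
    have "x \<in> X j" "x \<in> X (Suc j)"
      using chain_mono[OF chain, of j i] chain_mono[OF chain, of "Suc j" i] that x by auto
    then show ?thesis unfolding chain_haar_def density_gap_def c_def by (simp add: algebra_simps)
  qed
  have here: "chain_haar X i x = c i"
    using x unfolding chain_haar_def density_gap_def c_def by simp
  have late: "chain_haar X j x = 0" if "i < j" "j < n" for j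
  proof -
    have "x \<notin> X j" "x \<notin> X (Suc j)"
      using chain_mono[OF chain, of "Suc i" j] chain_mono[OF chain, of "Suc i" "Suc j"] that x by auto
    then show ?thesis unfolding chain_haar_def density_gap_def by simp
  qed
  have fin: "finite G" using G finite_subset by blast
  let ?s = "\<Sum>j\<in>G \<inter> {..<i}. c (Suc j) - c j"
  have "(\<Sum>j\<in>G. chain_haar X j x) = (\<Sum>j\<in>G \<inter> {..i}. chain_haar X j x)"
  proof (rule sum.mono_neutral_right)
    show "\<forall>j\<in>G - G \<inter> {..i}. chain_haar X j x = 0"
    proof
      fix j assume "j \<in> G - G \<inter> {..i}"
      then have "i < j" "j < n" using G by auto
      then show "chain_haar X j x = 0" by (rule late)
    qed
  qed (use fin in auto)
  also have "\<dots> = (\<Sum>j\<in>G \<inter> {..<i}. chain_haar X j x) + (\<Sum>j\<in>G \<inter> {i}. chain_haar X j x)"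
    using fin by (subst sum.union_disjoint[symmetric]) (auto intro!: sum.cong)
  also have "(\<Sum>j\<in>G \<inter> {..<i}. chain_haar X j x) = - ?s"
    unfolding sum_negf[symmetric] using early by (intro sum.cong) auto
  finally have eq: "(\<Sum>j\<in>G. chain_haar X j x) = - ?s + (\<Sum>j\<in>G \<inter> {i}. chain_haar X j x)" .
  have "0 \<le> ?s" using c_mono x(1) by (intro sum_nonneg) auto
  then show "i \<notin> G \<Longrightarrow> (\<Sum>j\<in>G. chain_haar X j x) \<le> 0" using eq by simp
  have "?s \<le> (\<Sum>j<i. c (Suc j) - c j)" using c_mono x(1) by (intro sum_mono2) auto
  also have "\<dots> = c i - 1" using pos[of 0] sum_lessThan_telescope[of c i] by (simp add: c_def)
  finally show "i \<in> G \<Longrightarrow> (\<Sum>j\<in>G. chain_haar X j x) \<ge> 1" using eq here by simp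
qed

end

context haar_basis
begin

lemma chain_haar_expansion:
  assumes "atom_chain F D D' D'' n X"
  obtains m a where "\<And>j. j < n \<Longrightarrow> m j \<ge> 1" "inj_on m {..<n}" "\<And>j. j < n \<Longrightarrow> a j \<noteq> 0"
    "\<And>j x. j < n \<Longrightarrow> chain_haar X j x = a j * \<phi> (m j) x"
proof -
  have "\<exists>m a. m \<ge> 1 \<and> X j = D m \<and> a \<noteq> 0 \<and> (\<forall>x. chain_haar X j x = a * \<phi> m x)" if j: "j < n" for j
  proof -
    obtain m where m: "m \<ge> 1" "X j = D m" "X (Suc j) \<in> {D' m, D'' m}"
      by (rule chain_step[OF assms j])
    obtain a where a: "a \<noteq> 0" "\<And>x. density_gap (D m) (X (Suc j)) x = a * \<phi> m x"
      using density_gap_eq_haar[OF m(1,3)] by blast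
    have "vol (X 0) \<noteq> 0" using atom_pos[OF chain_atom[OF assms, of 0]] by simp
    with m a have "m \<ge> 1 \<and> X j = D m \<and> vol (X 0) * a \<noteq> 0
        \<and> (\<forall>x. chain_haar X j x = vol (X 0) * a * \<phi> m x)"
      by (simp add: chain_haar_def)
    then show ?thesis by blast
  qed
  then obtain m a where ma: "\<And>j. j < n \<Longrightarrow> m j \<ge> 1 \<and> X j = D (m j) \<and> a j \<noteq> 0
      \<and> (\<forall>x. chain_haar X j x = a j * \<phi> (m j) x)"
    by metis
  have "inj_on m {..<n}"
  proof (rule linorder_inj_onI')
    fix i j assume "i \<in> {..<n}" "j \<in> {..<n}" "i < j"
    then show "m i \<noteq> m j" using chain_strict[OF assms, of i j] ma[of i] ma[of j] by auto
  qed
  with that ma show ?thesis by blast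
qed

text \<open>
  By \<open>chain_haar_expansion\<close>, \<open>f\<close> is a combination of Haar functions with nonzero coefficients.
  Orthonormality reads the Haar support off from it, and subsets of the chain correspond to subsets of the
  support.
\<close>

lemma chain_haar_support:
  assumes chain: "atom_chain F D D' D'' n X"
  defines "f \<equiv> \<lambda>x. \<Sum>j<n. chain_haar X j x"
  shows "(LINT x:Om|lebesgue. f x) = 0" "finite (haar_support \<phi> f)"
    and "haar_sum \<phi> f (haar_support \<phi> f) = f"
    and "G \<subseteq> {..<n} \<Longrightarrow>
      \<exists>\<Gamma>\<subseteq>haar_support \<phi> f. haar_sum \<phi> f \<Gamma> = (\<lambda>x. \<Sum>j\<in>G. chain_haar X j x)"
proof -
  obtain m a where m: "\<And>j. j < n \<Longrightarrow> m j \<ge> 1" and inj: "inj_on m {..<n}"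
    and a: "\<And>j. j < n \<Longrightarrow> a j \<noteq> 0" and h: "\<And>j x. j < n \<Longrightarrow> chain_haar X j x = a j * \<phi> (m j) x"
    by (rule chain_haar_expansion[OF chain]) (rule that)
  have f: "f = (\<lambda>x. \<Sum>j<n. a j * \<phi> (m j) x)" unfolding f_def using h by (intro ext sum.cong) auto
  have inner: "inner_Om f (\<phi> l) = (\<Sum>j<n. if m j = l then a j else 0)" for l
    unfolding f by (rule inner_haar_expansion) (use m in auto)
  have inner_m: "inner_Om f (\<phi> (m j)) = a j" if "j < n" for j
  proof -
    have "inner_Om f (\<phi> (m j)) = (\<Sum>i<n. if i = j then a i else 0)"
      unfolding inner using inj that by (intro sum.cong) (auto dest: inj_onD)
    then show ?thesis using that by simp
  qed
  have inner_other: "inner_Om f (\<phi> l) = 0" if "l \<notin> m ` {..<n}" for l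
    unfolding inner using that by (intro sum.neutral) auto
  have supp: "haar_support \<phi> f = m ` {..<n}"
    unfolding haar_support_def using inner_m inner_other a by auto
  then show "finite (haar_support \<phi> f)" by simp
  have sum_eq: "haar_sum \<phi> f (m ` J) = (\<lambda>x. \<Sum>j\<in>J. chain_haar X j x)" if "J \<subseteq> {..<n}" for J
  proof
    fix x
    have "haar_sum \<phi> f (m ` J) x = (\<Sum>j\<in>J. inner_Om f (\<phi> (m j)) * \<phi> (m j) x)"
      unfolding haar_sum_def using inj_on_subset[OF inj that] by (simp add: sum.reindex)
    also have "\<dots> = (\<Sum>j\<in>J. chain_haar X j x)"
      using that inner_m h by (intro sum.cong) (auto simp: subset_iff)
    finally show "haar_sum \<phi> f (m ` J) x = (\<Sum>j\<in>J. chain_haar X j x)" .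
  qed
  show "haar_sum \<phi> f (haar_support \<phi> f) = f" unfolding supp sum_eq[OF order_refl] by (simp add: f_def)
  show "\<exists>\<Gamma>\<subseteq>haar_support \<phi> f. haar_sum \<phi> f \<Gamma> = (\<lambda>x. \<Sum>j\<in>G. chain_haar X j x)" if "G \<subseteq> {..<n}"
    unfolding supp using sum_eq[OF that] image_mono[OF that, of m] by blast
  \<comment> \<open>The mean of \<open>f\<close> is its inner product with the constant function of index \<open>0\<close>.\<close>
  have "0 \<notin> m ` {..<n}" using m by fastforce
  then have "inner_Om f (\<phi> 0) = 0" by (rule inner_other)
  moreover have "inner_Om f (\<phi> 0) = (LINT x:Om|lebesgue. f x)"
    unfolding inner_Om_def haar_0 set_lebesgue_integral_def
    by (intro Bochner_Integration.integral_cong) (auto split: split_indicator)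
  ultimately show "(LINT x:Om|lebesgue. f x) = 0" by simp
qed

end

section \<open>Oscillation and the variation seminorm\<close>

lemma Lp_norm_nonneg: "0 \<le> Lp_norm p R f"
  unfolding Lp_norm_def by simp

lemma E_const_le_Lp_norm: "E_const p f R \<le> Lp_norm p R (\<lambda>x. f x - c)"
  unfolding E_const_def by (rule cINF_lower) (auto intro!: bdd_belowI[of _ 0] Lp_norm_nonneg)

lemma E_const_nonneg: "0 \<le> E_const p f R"
  unfolding E_const_def by (rule cINF_greatest) (auto intro: Lp_norm_nonneg)

lemma E_const_of_constant:
  assumes "p > 0" "\<forall>x\<in>R. f x = c"
  shows "E_const p f R = 0"
proof -
  have "indicator R x *\<^sub>R \<bar>f x - c\<bar> powr p = 0" for x
    using assms by (auto split: split_indicator)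
  then have "Lp_norm p R (\<lambda>x. f x - c) = 0"
    unfolding Lp_norm_def set_lebesgue_integral_def by (simp only:) simp
  then show ?thesis using E_const_le_Lp_norm[of p f R c] E_const_nonneg[of p f R] by simp
qed

text \<open>
  Every constant lies on one side of the midpoint of the gap and so stays at least half the gap
  away from all values on one of the two sets.
\<close>

lemma E_const_lower_bound:
  assumes "p > 0" and R: "R \<in> lmeasurable" and Q: "Q \<in> sets lebesgue" "Q \<subseteq> R"
    and Q': "Q' \<in> sets lebesgue" "Q' \<subseteq> R"
    and h: "h \<in> borel_measurable lebesgue" and K: "\<And>x. \<bar>h x\<bar> \<le> K"
    and gap: "\<alpha> \<le> \<beta>" "\<And>x. x \<in> Q \<Longrightarrow> \<beta> \<le> h x" "\<And>x. x \<in> Q' \<Longrightarrow> h x \<le> \<alpha>"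
  shows "(\<beta> - \<alpha>) / 2 * min (vol Q) (vol Q') powr (1 / p) \<le> E_const p h R"
  unfolding E_const_def
proof (rule cINF_greatest)
  fix c
  define \<delta> where "\<delta> = (\<beta> - \<alpha>) / 2"
  \<comment> \<open>The one of the two sets whose values lie on the far side of the midpoint from \<open>c\<close>.\<close>
  define T where "T = (if c \<le> (\<alpha> + \<beta>) / 2 then Q else Q')"
  have T: "T \<in> sets lebesgue" "T \<subseteq> R" using Q Q' by (auto simp: T_def)
  have \<delta>: "\<delta> \<ge> 0" using gap(1) by (simp add: \<delta>_def)
  have far: "\<delta> \<le> \<bar>h x - c\<bar>" if "x \<in> T" for x
  proof (cases "c \<le> (\<alpha> + \<beta>) / 2")
    case True
    then have "\<beta> \<le> h x" using that gap(2) by (simp add: T_def)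
    with True show ?thesis unfolding \<delta>_def by argo
  next
    case False
    then have "h x \<le> \<alpha>" using that gap(3) by (simp add: T_def)
    with False show ?thesis unfolding \<delta>_def by argo
  qed
  have bd: "\<bar>h x - c\<bar> powr p \<le> (K + \<bar>c\<bar>) powr p" for x
    using K[of x] \<open>p > 0\<close> by (intro powr_mono2) auto
  have "\<delta> powr p * vol T = (LINT x:R|lebesgue. \<delta> powr p * indicator T x + 0 * indicator {} x)"
    unfolding set_integral_step[OF R T(1) sets.empty_sets] using T(2) by (simp add: Int_absorb1)
  also have "\<dots> \<le> (LINT x:R|lebesgue. \<bar>h x - c\<bar> powr p)"
  proof (rule set_integral_mono)
    show "set_integrable lebesgue R (\<lambda>x. \<delta> powr p * indicator T x + 0 * indicator {} x)"
      using R T by (intro set_integrable_bounded[where K = "\<delta> powr p"]) (auto split: split_indicator)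
    show "set_integrable lebesgue R (\<lambda>x. \<bar>h x - c\<bar> powr p)"
      using R h bd by (intro set_integrable_bounded[where K = "(K + \<bar>c\<bar>) powr p"]) auto
    show "\<delta> powr p * indicator T x + 0 * indicator {} x \<le> \<bar>h x - c\<bar> powr p" for x
      using far[of x] \<delta> \<open>p > 0\<close> by (auto split: split_indicator intro!: powr_mono2)
  qed
  finally have le: "\<delta> powr p * vol T \<le> (LINT x:R|lebesgue. \<bar>h x - c\<bar> powr p)" .
  have "\<delta> * min (vol Q) (vol Q') powr (1 / p) \<le> \<delta> * vol T powr (1 / p)"
    using \<delta> \<open>p > 0\<close> by (intro mult_left_mono powr_mono2) (auto simp: T_def)
  also have "\<dots> = (\<delta> powr p * vol T) powr (1 / p)"
    using \<delta> \<open>p > 0\<close> by (simp add: powr_mult powr_powr)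
  also have "\<dots> \<le> Lp_norm p R (\<lambda>x. h x - c)"
    unfolding Lp_norm_def using le \<open>p > 0\<close> by (intro powr_mono2) auto
  finally show "(\<beta> - \<alpha>) / 2 * min (vol Q) (vol Q') powr (1 / p) \<le> Lp_norm p R (\<lambda>x. h x - c)"
    unfolding \<delta>_def .
qed simp

context haar_filtration
begin

lemma atom_or_ring_cases:
  assumes "R \<in> all_atoms F \<union> rings F"
  obtains A B where "R = A - B" "A \<in> all_atoms F" "B = {} \<or> B \<in> all_atoms F"
  using assms unfolding rings_def by blast

lemma atom_or_ring_lmeasurable:
  assumes "R \<in> all_atoms F \<union> rings F"
  shows "R \<in> lmeasurable" "R \<subseteq> Om"
proof -
  obtain A B where R: "R = A - B" "A \<in> all_atoms F" "B = {} \<or> B \<in> all_atoms F"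
    by (rule atom_or_ring_cases[OF assms])
  show "R \<in> lmeasurable" unfolding R(1)
    using R(2,3) atom_lmeasurable by (intro fmeasurable_Diff) auto
  show "R \<subseteq> Om" unfolding R(1) using atom_subset[OF R(2)] by blast
qed

text \<open>
  A ring or atom that sees two of the three values of such a function straddles the boundary of
  \<open>X\<close> or of \<open>Y\<close>. By nestedness it then contains all that a larger atom adds to \<open>X\<close> or to
  \<open>Y\<close>, or it contains \<open>Y\<close>.
\<close>

lemma nonconstant_cases:
  assumes X: "X \<in> all_atoms F" and Y: "Y \<in> all_atoms F" "Y \<subseteq> X"
    and R: "R \<in> all_atoms F \<union> rings F"
    and f: "f = (\<lambda>x. indicator (X - Y) x - \<gamma> * indicator Y x :: real)"
    and nonconst: "\<nexists>c. \<forall>x\<in>R. f x = c"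
  shows "(\<exists>A\<in>all_atoms F. X \<subset> A \<and> A - X \<subseteq> R) \<or> (\<exists>A\<in>all_atoms F. Y \<subset> A \<and> A - Y \<subseteq> R) \<or> Y \<subseteq> R"
proof -
  obtain A B where AB: "R = A - B" "A \<in> all_atoms F" "B = {} \<or> B \<in> all_atoms F"
    by (rule atom_or_ring_cases[OF R])
  have nested_B: "B \<subseteq> Z \<or> Z \<subseteq> B \<or> B \<inter> Z = {}" if "Z \<in> all_atoms F" for Z
    using AB(3) atoms_nested[OF _ that] by auto
  have Y_ne: "Y \<noteq> {}" using atom_pos[OF Y(1)] by auto
  have not_in_Y: "\<not> R \<subseteq> Y"
  proof
    assume "R \<subseteq> Y"
    then have "\<forall>x\<in>R. f x = - \<gamma>" by (auto simp: f)
    with nonconst show False by blast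
  qed
  have not_between: "\<not> R \<subseteq> X - Y"
  proof
    assume "R \<subseteq> X - Y"
    then have "\<forall>x\<in>R. f x = 1" by (auto simp: f)
    with nonconst show False by blast
  qed
  have not_outside: "R \<inter> X \<noteq> {}"
  proof
    assume "R \<inter> X = {}"
    then have "\<forall>x\<in>R. f x = 0" using Y(2) by (auto simp: f split: split_indicator)
    with nonconst show False by blast
  qed
  have YA: "Y \<subset> A"
  proof -
    have "Y \<subseteq> A" if "A \<inter> Y = {}"
      using atoms_nested[OF AB(2) X] that not_between not_outside AB(1) Y(2) by blast
    then show ?thesis using atoms_nested[OF AB(2) Y(1)] not_in_Y AB(1) by blast
  qed
  consider "B \<subseteq> Y" | "Y \<subseteq> B" "\<not> B \<subseteq> Y" | "B \<inter> Y = {}" using nested_B[OF Y(1)] by blast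
  then show ?thesis
  proof cases
    case 1
    then show ?thesis using AB YA by blast
  next
    case 2
    then have BX: "B \<subseteq> X" using nested_B[OF X] not_outside AB(1) Y(2) Y_ne by blast
    then have "\<not> A \<subseteq> X" using 2 not_between AB(1) by blast
    then have "X \<subset> A" using atoms_nested[OF AB(2) X] YA Y(2) Y_ne by blast
    then show ?thesis using AB BX by blast
  next
    case 3
    then show ?thesis using AB YA by blast
  qed
qed

text \<open>
  Two atoms that properly contain \<open>Z\<close> are nested, so sets that contain the differences to \<open>Z\<close>
  intersect.
\<close>

lemma card_straddling:
  assumes "finite P" "disjoint P" "Z \<in> all_atoms F"
  shows "card {R \<in> P. \<exists>A\<in>all_atoms F. Z \<subset> A \<and> A - Z \<subseteq> R} \<le> 1"
proof -
  let ?S = "{R \<in> P. \<exists>A\<in>all_atoms F. Z \<subset> A \<and> A - Z \<subseteq> R}"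
  have "R = R'" if R: "R \<in> P" "A \<in> all_atoms F" "Z \<subset> A" "A - Z \<subseteq> R"
    and R': "R' \<in> P" "A' \<in> all_atoms F" "Z \<subset> A'" "A' - Z \<subseteq> R'" for R R' A A'
  proof -
    have "Z \<noteq> {}" using atom_pos[OF assms(3)] by auto
    then have "A \<subseteq> A' \<or> A' \<subseteq> A" using atoms_nested[OF R(2) R'(2)] R(3) R'(3) by blast
    then have "R \<inter> R' \<noteq> {}" using R(3,4) R'(3,4) by blast
    then show ?thesis using disjointD[OF assms(2) R(1) R'(1)] by blast
  qed
  then have "\<forall>R\<in>?S. \<forall>R'\<in>?S. R = R'" by blast
  then show ?thesis using assms(1) by (simp add: card_le_Suc0_iff_eq)
qed

lemma card_nonconstant:
  assumes P: "finite P" "P \<subseteq> all_atoms F \<union> rings F" "disjoint P"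
    and X: "X \<in> all_atoms F" and Y: "Y \<in> all_atoms F" "Y \<subseteq> X"
    and f: "f = (\<lambda>x. indicator (X - Y) x - \<gamma> * indicator Y x :: real)"
  shows "card {R \<in> P. \<nexists>c. \<forall>x\<in>R. f x = c} \<le> 3"
proof -
  let ?S = "\<lambda>Z. {R \<in> P. \<exists>A\<in>all_atoms F. Z \<subset> A \<and> A - Z \<subseteq> R}"
  let ?T = "{R \<in> P. Y \<subseteq> R}"
  have "Y \<noteq> {}" using atom_pos[OF Y(1)] by auto
  have "R = R'" if "R \<in> ?T" "R' \<in> ?T" for R R'
    using that \<open>Y \<noteq> {}\<close> disjointD[OF P(3), of R R'] by blast
  then have T: "card ?T \<le> 1" using P(1) by (simp add: card_le_Suc0_iff_eq)
  have "{R \<in> P. \<nexists>c. \<forall>x\<in>R. f x = c} \<subseteq> ?S X \<union> ?S Y \<union> ?T"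
  proof
    fix R assume "R \<in> {R \<in> P. \<nexists>c. \<forall>x\<in>R. f x = c}"
    then show "R \<in> ?S X \<union> ?S Y \<union> ?T"
      using nonconstant_cases[OF X Y _ f, of R] P(2) by blast
  qed
  then have "card {R \<in> P. \<nexists>c. \<forall>x\<in>R. f x = c} \<le> card (?S X \<union> ?S Y \<union> ?T)"
    using P(1) by (intro card_mono) auto
  also have "\<dots> \<le> card (?S X) + card (?S Y) + card ?T"
    using card_Un_le[of "?S X \<union> ?S Y" ?T] card_Un_le[of "?S X" "?S Y"] by linarith
  finally show ?thesis
    using T card_straddling[OF P(1,3) X] card_straddling[OF P(1,3) Y(1)] by linarith
qed

text \<open>
  The value \<open>\<gamma> = vol (X - Y) / vol Y\<close> makes the mean vanish, that is \<open>\<gamma> * vol Y = vol (X - Y)\<close>.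
  As \<open>Y\<close> fills half of \<open>X\<close>, \<open>\<gamma> \<le> 1\<close> and hence \<open>\<gamma> powr p \<le> \<gamma>\<close>, so both parts contribute at
  most \<open>vol (X - Y)\<close> to the integral.
\<close>

lemma Lp_norm_two_step_le:
  assumes "1 < p" and X: "X \<in> all_atoms F" and Y: "Y \<in> all_atoms F" "Y \<subseteq> X"
    and large: "vol Y \<ge> 1 / 2 * vol X"
    and f: "f = (\<lambda>x. indicator (X - Y) x - vol (X - Y) / vol Y * indicator Y x :: real)"
    and R: "R \<in> lmeasurable"
  shows "Lp_norm p R f \<le> (2 * vol (X - Y)) powr (1 / p)"
proof -
  define \<gamma> where "\<gamma> = vol (X - Y) / vol Y"
  have sets: "X - Y \<in> sets lebesgue" "Y \<in> sets lebesgue" using X Y atom_sets by auto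
  have Y_pos: "vol Y > 0" using atom_pos[OF Y(1)] .
  have diff: "vol (X - Y) = vol X - vol Y"
    using measurable_measure_Diff[OF atom_lmeasurable[OF X] sets(2) Y(2)] .
  have YX: "vol Y \<le> vol X"
    by (rule measure_mono_fmeasurable[OF Y(2) sets(2) atom_lmeasurable[OF X]])
  have \<gamma>: "0 \<le> \<gamma>" "\<gamma> \<le> 1" "\<gamma> * vol Y = vol (X - Y)"
    using Y_pos large by (simp_all add: \<gamma>_def diff field_simps YX)
  have "\<bar>f x\<bar> powr p = 1 * indicator (X - Y) x + \<gamma> powr p * indicator Y x" for x
    using \<gamma>(1) by (auto simp: f \<gamma>_def split: split_indicator)
  then have "(LINT x:R|lebesgue. \<bar>f x\<bar> powr p)
      = 1 * vol (R \<inter> (X - Y)) + \<gamma> powr p * vol (R \<inter> Y)"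
    by (simp only: set_integral_step[OF R sets])
  also have "\<dots> \<le> 1 * vol (X - Y) + \<gamma> powr 1 * vol Y"
    using R sets X Y \<gamma>(1,2) \<open>1 < p\<close> atom_lmeasurable
    by (intro add_mono mult_mono measure_mono_fmeasurable powr_mono' fmeasurable_Diff) auto
  also have "\<dots> = 2 * vol (X - Y)" using \<gamma> by simp
  finally have le: "(LINT x:R|lebesgue. \<bar>f x\<bar> powr p) \<le> 2 * vol (X - Y)" .
  have "0 \<le> (LINT x:R|lebesgue. \<bar>f x\<bar> powr p)"
    unfolding set_lebesgue_integral_def by (intro Bochner_Integration.integral_nonneg) simp
  then show ?thesis unfolding Lp_norm_def using le \<open>1 < p\<close> by (intro powr_mono2) auto
qed

text \<open>
  At most three sets of a competing collection contribute to the variation, each at most the bound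
  for the \<open>L\<^sup>p\<close> norm; the summand \<open>1\<close> of the constant accounts for the \<open>L\<^sup>p\<close> norm itself.
\<close>

lemma V_norm_two_step_le:
  assumes "1 < p" "0 < \<sigma>" and X: "X \<in> all_atoms F" and Y: "Y \<in> all_atoms F" "Y \<subseteq> X"
    and large: "vol Y \<ge> 1 / 2 * vol X"
    and f: "f = (\<lambda>x. indicator (X - Y) x - vol (X - Y) / vol Y * indicator Y x :: real)"
  shows "V_norm F \<sigma> p f
    \<le> ereal ((1 + 3 powr (1 / \<sigma>)) * 2 powr (1 / p) * vol (X - Y) powr (1 / p))"
proof -
  define K where "K = (2 * vol (X - Y)) powr (1 / p)"
  have norm: "Lp_norm p R f \<le> K" if "R \<in> lmeasurable" for R
    unfolding K_def by (rule Lp_norm_two_step_le[OF assms(1) X Y large f that])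
  have "V_seminorm F \<sigma> p f \<le> ereal (3 powr (1 / \<sigma>) * K)"
    unfolding V_seminorm_def
  proof (rule SUP_least)
    fix P assume "P \<in> {P. finite P \<and> P \<subseteq> all_atoms F \<union> rings F \<and> disjoint P}"
    then have P: "finite P" "P \<subseteq> all_atoms F \<union> rings F" "disjoint P" by auto
    let ?N = "{R \<in> P. \<nexists>c. \<forall>x\<in>R. f x = c}"
    have "E_const p f R = 0" if "R \<in> P - ?N" for R
      using that E_const_of_constant[of p R f] \<open>1 < p\<close> by auto
    then have "(\<Sum>R\<in>P. E_const p f R powr \<sigma>) = (\<Sum>R\<in>?N. E_const p f R powr \<sigma>)"
      using P(1) by (intro sum.mono_neutral_right) auto
    also have "\<dots> \<le> (\<Sum>R\<in>?N. K powr \<sigma>)"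
    proof (rule sum_mono)
      fix R assume "R \<in> ?N"
      then have "R \<in> lmeasurable" using P(2) atom_or_ring_lmeasurable(1) by blast
      then have "E_const p f R \<le> K"
        using E_const_le_Lp_norm[of p f R 0] norm[of R] by simp
      then show "E_const p f R powr \<sigma> \<le> K powr \<sigma>"
        using \<open>0 < \<sigma>\<close> by (intro powr_mono2 E_const_nonneg) auto
    qed
    also have "\<dots> \<le> 3 * K powr \<sigma>"
      using card_nonconstant[OF P X Y f] by (simp add: mult_right_mono)
    finally have "(\<Sum>R\<in>P. E_const p f R powr \<sigma>) powr (1 / \<sigma>) \<le> (3 * K powr \<sigma>) powr (1 / \<sigma>)"
      using \<open>0 < \<sigma>\<close> by (intro powr_mono2 sum_nonneg) auto
    also have "\<dots> = 3 powr (1 / \<sigma>) * K"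
      using \<open>0 < \<sigma>\<close> by (simp add: powr_mult powr_powr K_def)
    finally show "ereal ((\<Sum>R\<in>P. E_const p f R powr \<sigma>) powr (1 / \<sigma>)) \<le> ereal (3 powr (1 / \<sigma>) * K)"
      by simp
  qed
  then have "V_norm F \<sigma> p f \<le> ereal K + ereal (3 powr (1 / \<sigma>) * K)"
    unfolding V_norm_def using norm[OF Om_lmeasurable] by (intro add_mono) auto
  also have "\<dots> = ereal ((1 + 3 powr (1 / \<sigma>)) * 2 powr (1 / p) * vol (X - Y) powr (1 / p))"
    by (simp add: K_def powr_mult algebra_simps)
  finally show ?thesis .
qed

end

section \<open>A partial Haar sum of large variation\<close>

lemma break_points_mono:
  fixes lam :: "nat \<Rightarrow> nat"
  assumes "\<forall>i<k. lam i < lam (Suc i)" "i \<le> j" "j \<le> k"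
  shows "lam i \<le> lam j"
  using assms(2,3)
proof (induction j rule: dec_induct)
  case (step j)
  then have "lam i \<le> lam j" "lam j < lam (Suc j)" using assms(1) by auto
  then show ?case by simp
qed simp

lemma break_points_Union_subset:
  fixes lam :: "nat \<Rightarrow> nat"
  assumes inc: "\<forall>i<k. lam i < lam (Suc i)" and \<Gamma>: "\<forall>i<k. \<Gamma> i \<subseteq> {lam i..<lam (Suc i)}"
  shows "(\<Union>i<k. \<Gamma> i) \<subseteq> {..<lam k}"
proof
  fix j assume "j \<in> (\<Union>i<k. \<Gamma> i)"
  then obtain i where "i < k" "j \<in> {lam i..<lam (Suc i)}" using \<Gamma> by blast
  then show "j \<in> {..<lam k}" using break_points_mono[OF inc, of "Suc i" k] by simp
qed

lemma break_points_disjoint: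
  fixes lam :: "nat \<Rightarrow> nat"
  assumes inc: "\<forall>i<k. lam i < lam (Suc i)" and "i < k" "i' < k"
    and "j \<in> {lam i..<lam (Suc i)}" "j \<in> {lam i'..<lam (Suc i')}"
  shows "i = i'"
  using break_points_mono[OF inc, of "Suc i" i'] break_points_mono[OF inc, of "Suc i'" i] assms
  by (cases i i' rule: linorder_cases) auto

context haar_filtration
begin

lemma chain_haar_bounded_measurable:
  assumes "atom_chain F D D' D'' n X" "G \<subseteq> {..<n}"
  defines "g \<equiv> \<lambda>x. \<Sum>j\<in>G. chain_haar X j x"
  shows "g \<in> borel_measurable lebesgue" "\<exists>K. \<forall>x. \<bar>g x\<bar> \<le> K"
proof -
  have "X j \<in> sets lebesgue" if "j \<le> n" for j using atom_sets[OF chain_atom[OF assms(1) that]] .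
  then have "chain_haar X j \<in> borel_measurable lebesgue" if "j \<in> G" for j
    using that assms(2) density_gap_measurable[of "X j" "X (Suc j)"] unfolding chain_haar_def by auto
  then show "g \<in> borel_measurable lebesgue"
    unfolding g_def by (intro borel_measurable_sum) auto
  have "\<bar>g x\<bar> \<le> (\<Sum>j\<in>G. vol (X 0) * (1 / vol (X j) + 1 / vol (X (Suc j))))" for x
    unfolding g_def chain_haar_def
    by (intro order_trans[OF sum_abs] sum_mono)
       (simp only: abs_mult abs_of_nonneg[OF measure_nonneg] mult_left_mono[OF abs_density_gap_le measure_nonneg])
  then show "\<exists>K. \<forall>x. \<bar>g x\<bar> \<le> K" by blast
qed

text \<open>
  The rings \<open>R i\<close> are an admissible collection for the variation, and on each of them the partial
  sum jumps by at least \<open>1\<close> between \<open>Q i\<close> and the rest of \<open>R i\<close>.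
\<close>

lemma V_seminorm_partial_sum_ge:
  assumes chain: "atom_chain F D D' D'' n X" and "0 < p" "0 < \<sigma>"
    and lam: "lam 0 = 0" "lam k = n" "\<forall>i<k. lam i < lam (Suc i)"
    and \<Gamma>: "\<forall>i<k. \<Gamma> i \<subseteq> {lam i..<lam (Suc i)}"
  defines "R \<equiv> \<lambda>i. chain_part X {lam i..<lam (Suc i)}" and "Q \<equiv> \<lambda>i. chain_part X (\<Gamma> i)"
  shows "ereal (1 / 2 * (\<Sum>i<k. min (vol (Q i)) (vol (R i - Q i)) powr (\<sigma> / p)) powr (1 / \<sigma>))
    \<le> V_seminorm F \<sigma> p (\<lambda>x. \<Sum>j\<in>(\<Union>i<k. \<Gamma> i). chain_haar X j x)"
proof -
  define G where "G = (\<Union>i<k. \<Gamma> i)"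
  define g where "g = (\<lambda>x. \<Sum>j\<in>G. chain_haar X j x)"
  have lam_le: "lam i \<le> n" if "i \<le> k" for i
    using break_points_mono[OF lam(3) that] lam(2) by simp
  have G: "G \<subseteq> {..<n}" using break_points_Union_subset[OF lam(3) \<Gamma>] lam(2) by (simp add: G_def)
  have R_eq: "R i = X (lam i) - X (lam (Suc i))" if "i < k" for i
    unfolding R_def using chain_part_interval[OF chain] lam(3) lam_le that by auto
  have ring: "R i \<in> rings F" if "i < k" for i
  proof -
    have "X (lam (Suc i)) \<subset> X (lam i)"
      using chain_strict[OF chain, of "lam i" "lam (Suc i)"] lam(3) lam_le[of "Suc i"] that by simp
    then show ?thesis
      unfolding R_eq[OF that] rings_def mem_Collect_eq
      using chain_atom[OF chain] lam_le[of i] lam_le[of "Suc i"] that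
      by (intro exI[of _ "X (lam i)"] exI[of _ "X (lam (Suc i))"] conjI refl) auto
  qed
  have R_ne: "R i \<noteq> {}" if "i < k" for i using ring[OF that] unfolding rings_def by blast
  have R_disj': "R i \<inter> R i' = {}" if "i < i'" "i' < k" for i i'
  proof -
    have "lam (Suc i) \<le> lam i'" using break_points_mono[OF lam(3), of "Suc i" i'] that by simp
    then have "X (lam i') \<subseteq> X (lam (Suc i))" using chain_mono[OF chain] lam_le[of i'] that by simp
    then show ?thesis using R_eq[of i] R_eq[of i'] that by auto
  qed
  have R_disj: "R i \<inter> R i' = {}" if "i < k" "i' < k" "i \<noteq> i'" for i i'
    using R_disj'[of i i'] R_disj'[of i' i] that by (cases i i' rule: linorder_cases) auto
  have inj: "inj_on R {..<k}" using R_disj R_ne unfolding inj_on_def by fastforce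
  have osc: "1 / 2 * min (vol (Q i)) (vol (R i - Q i)) powr (1 / p) \<le> E_const p g (R i)" if i: "i < k" for i
  proof -
    have Q_sub: "Q i \<subseteq> R i" using \<Gamma> i unfolding Q_def R_def chain_part_def by blast
    have "finite (\<Gamma> i)" using \<Gamma> i finite_subset by blast
    moreover have "X j - X (Suc j) \<in> sets lebesgue" if "j \<in> \<Gamma> i" for j
    proof -
      have "j < n" using \<Gamma> i that lam_le[of "Suc i"] by fastforce
      then show ?thesis using chain_atom[OF chain] atom_sets by (intro sets.Diff) auto
    qed
    ultimately have Q_sets: "Q i \<in> sets lebesgue"
      unfolding Q_def chain_part_def by (intro sets.finite_UN) auto
    have R_meas: "R i \<in> lmeasurable" using atom_or_ring_lmeasurable(1) ring[OF i] by blast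
    obtain K where K: "\<And>x. \<bar>g x\<bar> \<le> K"
      using chain_haar_bounded_measurable(2)[OF chain G] unfolding g_def by blast
    have high: "1 \<le> g x" if x: "x \<in> Q i" for x
    proof -
      obtain j where j: "j \<in> \<Gamma> i" "x \<in> X j" "x \<notin> X (Suc j)"
        using x unfolding Q_def chain_part_def by blast
      then have "j \<in> G" using i unfolding G_def by blast
      then show ?thesis
        using partial_sum_chain_haar(1)[OF chain G _ j(2,3)] G unfolding g_def by auto
    qed
    have low: "g x \<le> 0" if x: "x \<in> R i - Q i" for x
    proof -
      obtain j where j: "j \<in> {lam i..<lam (Suc i)}" "x \<in> X j" "x \<notin> X (Suc j)"
        using x unfolding R_def chain_part_def by blast
      then have "j \<notin> \<Gamma> i" using x unfolding Q_def chain_part_def by blast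
      then have "j \<notin> G"
        using break_points_disjoint[OF lam(3) i _ j(1)] \<Gamma> unfolding G_def by blast
      moreover have "j < n" using j(1) lam_le[of "Suc i"] i by simp
      ultimately show ?thesis
        using partial_sum_chain_haar(2)[OF chain G _ j(2,3)] unfolding g_def by simp
    qed
    have "(1 - 0) / 2 * min (vol (Q i)) (vol (R i - Q i)) powr (1 / p) \<le> E_const p g (R i)"
      using \<open>0 < p\<close> R_meas Q_sets Q_sub
        chain_haar_bounded_measurable(1)[OF chain G, folded g_def] K high low
      by (intro E_const_lower_bound[where K = K]) auto
    then show ?thesis by simp
  qed
  let ?s = "\<Sum>i<k. min (vol (Q i)) (vol (R i - Q i)) powr (\<sigma> / p)"
  have "(1 / 2) powr \<sigma> * ?s = (\<Sum>i<k. (1 / 2 * min (vol (Q i)) (vol (R i - Q i)) powr (1 / p)) powr \<sigma>)"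
    unfolding sum_distrib_left using \<open>0 < p\<close> by (intro sum.cong) (simp_all add: powr_mult powr_powr powr_divide)
  also have "\<dots> \<le> (\<Sum>i<k. E_const p g (R i) powr \<sigma>)"
    using osc \<open>0 < \<sigma>\<close> by (intro sum_mono powr_mono2) auto
  also have "\<dots> = (\<Sum>S\<in>R ` {..<k}. E_const p g S powr \<sigma>)"
    using inj by (simp add: sum.reindex)
  finally have le: "(1 / 2) powr \<sigma> * ?s \<le> (\<Sum>S\<in>R ` {..<k}. E_const p g S powr \<sigma>)" .
  have "1 / 2 * ?s powr (1 / \<sigma>) = ((1 / 2) powr \<sigma> * ?s) powr (1 / \<sigma>)"
    using \<open>0 < \<sigma>\<close> by (simp add: powr_mult powr_powr sum_nonneg)
  also have "\<dots> \<le> (\<Sum>S\<in>R ` {..<k}. E_const p g S powr \<sigma>) powr (1 / \<sigma>)"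
    using le \<open>0 < \<sigma>\<close> by (intro powr_mono2) (auto intro!: sum_nonneg mult_nonneg_nonneg)
  finally have "ereal (1 / 2 * ?s powr (1 / \<sigma>))
      \<le> ereal ((\<Sum>S\<in>R ` {..<k}. E_const p g S powr \<sigma>) powr (1 / \<sigma>))" by simp
  also have "\<dots> \<le> V_seminorm F \<sigma> p g"
    unfolding V_seminorm_def
  proof (rule SUP_upper)
    have "disjoint (R ` {..<k})"
      using R_disj by (intro disjointI) auto
    then show "R ` {..<k} \<in> {P. finite P \<and> P \<subseteq> all_atoms F \<union> rings F \<and> disjoint P}"
      using ring by auto
  qed
  finally show ?thesis unfolding g_def G_def .
qed

lemma not_w3_obtain:
  assumes "\<not> w3 F D D' D'' p \<sigma>" "0 < \<rho>" "\<rho> < 1" "0 < M"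
  obtains n X k lam \<Gamma> where "atom_chain F D D' D'' n X" "vol (X n) \<ge> \<rho> * vol (X 0)"
    "lam 0 = 0" "lam k = n" "\<forall>i<k. lam i < lam (Suc i)" "\<forall>i<k. \<Gamma> i \<subseteq> {lam i..<lam (Suc i)}"
    "M * vol (X 0 - X n) powr (1 / p) <
      (\<Sum>i<k. min (vol (chain_part X (\<Gamma> i)))
        (vol (chain_part X {lam i..<lam (Suc i)} - chain_part X (\<Gamma> i))) powr (\<sigma> / p)) powr (1 / \<sigma>)"
proof (rule ccontr)
  assume contra: "\<not> thesis"
  have "w3 F D D' D'' p \<sigma>"
    unfolding w3_def Let_def
  proof (rule exI[of _ \<rho>], rule exI[of _ M], intro conjI allI impI)
    fix n X k lam \<Gamma>
    assume 1: "atom_chain F D D' D'' n X \<and> \<rho> * vol (X 0) \<le> vol (X n)"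
      and 2: "lam 0 = 0 \<and> lam k = n \<and> (\<forall>i<k. lam i < lam (Suc i)) \<and>
        (\<forall>i<k. \<Gamma> i \<subseteq> {lam i..<lam (Suc i)})"
    show "(\<Sum>i<k. min (vol (chain_part X (\<Gamma> i)))
        (vol (chain_part X {lam i..<lam (Suc i)} - chain_part X (\<Gamma> i))) powr (\<sigma> / p)) powr (1 / \<sigma>)
      \<le> M * vol (X 0 - X n) powr (1 / p)"
    proof (rule leI, rule notI)
      assume big: "M * vol (X 0 - X n) powr (1 / p) <
        (\<Sum>i<k. min (vol (chain_part X (\<Gamma> i)))
          (vol (chain_part X {lam i..<lam (Suc i)} - chain_part X (\<Gamma> i))) powr (\<sigma> / p)) powr (1 / \<sigma>)"
      show False
        by (rule notE[OF contra], rule that[OF _ _ _ _ _ _ big]) (use 1 2 in simp_all)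
    qed
  qed (use assms(2-) in auto)
  with assms(1) show False ..
qed

end

theorem proposition4p8:
  fixes F :: "nat \<Rightarrow> real set set"
    and D D' D'' :: "nat \<Rightarrow> real set"
    and \<phi> :: "nat \<Rightarrow> real \<Rightarrow> real"
    and p \<sigma> :: real
  assumes "binary_filtration F D D' D''"
    and "haar_system D D' D'' \<phi>"
    and "1 < p" and "0 < \<sigma>" and "\<sigma> < p"
    and "\<not> w3 F D D' D'' p \<sigma>"
  shows "\<exists>C>0. \<exists>c>0. \<forall>N::nat. N \<ge> 1 \<longrightarrow>
    (\<exists>n X \<gamma>. n \<ge> 1 \<and> atom_chain F D D' D'' n X \<and>
      (let f = (\<lambda>x. indicator (X 0 - X n) x - \<gamma> * indicator (X n) x) :: real \<Rightarrow> real;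
           v = vol (X 0 - X n) powr (1 / p)
       in (LINT x:Om|lebesgue. f x) = 0 \<and>
          finite (haar_support \<phi> f) \<and>
          V_norm F \<sigma> p f = V_norm F \<sigma> p (haar_sum \<phi> f (haar_support \<phi> f)) \<and>
          V_norm F \<sigma> p f \<le> ereal (C * v) \<and>
          (\<exists>\<Gamma> \<subseteq> haar_support \<phi> f.
             V_seminorm F \<sigma> p (haar_sum \<phi> f \<Gamma>) \<ge> ereal (c * real N * v))))"
proof -
  interpret haar_basis F D D' D'' \<phi>
    using assms(1,2) by unfold_locales
  define C where "C = (1 + 3 powr (1 / \<sigma>)) * 2 powr (1 / p)"
  have "C > 0" unfolding C_def by (intro mult_pos_pos add_pos_nonneg) auto
  show ?thesis
  proof (rule exI[of _ C], rule conjI[OF \<open>C > 0\<close>], rule exI[of _ "1 / 2"],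
      rule conjI, simp, intro allI impI)
    fix N :: nat assume "N \<ge> 1"
    then have "0 < real N" by simp
    obtain n X k lam \<Gamma> where chain: "atom_chain F D D' D'' n X"
      and large: "vol (X n) \<ge> 1 / 2 * vol (X 0)"
      and lam: "lam 0 = 0" "lam k = n" "\<forall>i<k. lam i < lam (Suc i)"
      and \<Gamma>: "\<forall>i<k. \<Gamma> i \<subseteq> {lam i..<lam (Suc i)}"
      and big: "real N * vol (X 0 - X n) powr (1 / p) <
      (\<Sum>i<k. min (vol (chain_part X (\<Gamma> i)))
        (vol (chain_part X {lam i..<lam (Suc i)} - chain_part X (\<Gamma> i))) powr (\<sigma> / p)) powr (1 / \<sigma>)"
      by (rule not_w3_obtain[OF assms(6) _ _ \<open>0 < real N\<close>, of "1 / 2"]) (simp, simp, rule that)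
    \<comment> \<open>A chain of length \<open>0\<close> has only the empty partition, whose sum is \<open>0\<close>.\<close>
    have "n \<ge> 1"
    proof (rule ccontr)
      assume "\<not> n \<ge> 1"
      then have "k = 0" using break_points_mono[OF lam(3), of 1 k] lam by (cases k) force+
      have "0 \<le> real N * vol (X 0 - X n) powr (1 / p)" by simp
      moreover have "real N * vol (X 0 - X n) powr (1 / p) < 0"
        using big unfolding \<open>k = 0\<close> by simp
      ultimately show False by linarith
    qed
    define \<gamma> where "\<gamma> = vol (X 0 - X n) / vol (X n)"
    define f where "f = (\<lambda>x. indicator (X 0 - X n) x - \<gamma> * indicator (X n) x :: real)"
    have f_sum: "f = (\<lambda>x. \<Sum>j<n. chain_haar X j x)"
      unfolding f_def \<gamma>_def sum_chain_haar[OF chain] ..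
    note supp = chain_haar_support[OF chain, folded f_sum]
    have upper: "V_norm F \<sigma> p f \<le> ereal (C * vol (X 0 - X n) powr (1 / p))"
      unfolding C_def
      by (rule V_norm_two_step_le[OF assms(3,4)])
         (use chain_atom[OF chain] chain_mono[OF chain] large in \<open>auto simp: f_def \<gamma>_def\<close>)
    define G where "G = (\<Union>i<k. \<Gamma> i)"
    have G: "G \<subseteq> {..<n}" using break_points_Union_subset[OF lam(3) \<Gamma>] lam(2) by (simp add: G_def)
    obtain \<Delta> where \<Delta>: "\<Delta> \<subseteq> haar_support \<phi> f" "haar_sum \<phi> f \<Delta> = (\<lambda>x. \<Sum>j\<in>G. chain_haar X j x)"
      using supp(4)[OF G] by blast
    have "ereal (1 / 2 * real N * vol (X 0 - X n) powr (1 / p))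
      \<le> ereal (1 / 2 * (\<Sum>i<k. min (vol (chain_part X (\<Gamma> i)))
        (vol (chain_part X {lam i..<lam (Suc i)} - chain_part X (\<Gamma> i))) powr (\<sigma> / p)) powr (1 / \<sigma>))"
      using big by simp
    also have "\<dots> \<le> V_seminorm F \<sigma> p (haar_sum \<phi> f \<Delta>)"
      unfolding \<Delta>(2) G_def using assms(3,4)
      by (intro V_seminorm_partial_sum_ge[OF chain _ _ lam \<Gamma>]) auto
    finally have lower: "ereal (1 / 2 * real N * vol (X 0 - X n) powr (1 / p))
      \<le> V_seminorm F \<sigma> p (haar_sum \<phi> f \<Delta>)" .
    show "\<exists>n X \<gamma>. n \<ge> 1 \<and> atom_chain F D D' D'' n X \<and>
      (let f = (\<lambda>x. indicator (X 0 - X n) x - \<gamma> * indicator (X n) x) :: real \<Rightarrow> real;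
           v = vol (X 0 - X n) powr (1 / p)
       in (LINT x:Om|lebesgue. f x) = 0 \<and>
          finite (haar_support \<phi> f) \<and>
          V_norm F \<sigma> p f = V_norm F \<sigma> p (haar_sum \<phi> f (haar_support \<phi> f)) \<and>
          V_norm F \<sigma> p f \<le> ereal (C * v) \<and>
          (\<exists>\<Gamma> \<subseteq> haar_support \<phi> f.
             V_seminorm F \<sigma> p (haar_sum \<phi> f \<Gamma>) \<ge> ereal (1 / 2 * real N * v)))"
      unfolding Let_def
      by (rule exI[of _ n], rule exI[of _ X], rule exI[of _ \<gamma>], fold f_def)
         (use \<open>n \<ge> 1\<close> chain supp(1-3) upper \<Delta>(1) lower in \<open>intro conjI exI[of _ \<Delta>]; simp\<close>)
  qed
qed

end
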